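(* Let $h:\mathbb{C}\to\mathbb{R}$ be a smooth map and $E_h:=\{x+iy\in\mathbb{C} : h(x,y)=0\}$ with $dh\neq 0$ on $E_h$. Let $K$ be a connected, simply-coconnected compact subset of $M:=E_h\times\mathbb{C}$ such that each fiber $K_c:=\{w\in\mathbb{C} : (c,w)\in K\}$ is polynomially convex. Then $K$ is polynomially convex.
   Context: A compact set $K\subset\mathbb{C}^n$ is simply-coconnected if for every continuous map $f:K\to\mathbb{C}\setminus\{0\}$ there is a continuous map $\psi:K\to\mathbb{C}$ with $f=\exp(\psi)$ (equivalently, $\check{H}^1(K;\mathbb{Z})=0$). For a compact $K\subset\mathbb{C}^n$, $\widehat{K}:=\{z\in\mathbb{C}^n : |p(z)|\le \sup_K|p| \text{ for all holomorphic polynomials } p\}$, and $K$ is polynomially convex if $\widehat{K}=K$. *)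

theory Defs
  imports "HOL-Analysis.Analysis"
begin

definition pderiv_dir :: "complex \<Rightarrow> (complex \<Rightarrow> real) \<Rightarrow> complex \<Rightarrow> real" where
  "pderiv_dir v g = (\<lambda>z. frechet_derivative g (at z) v)"

definition smooth_real :: "(complex \<Rightarrow> real) \<Rightarrow> bool" where
  "smooth_real h \<longleftrightarrow>
     (\<forall>ds. set ds \<subseteq> {1, \<i>} \<longrightarrow> (\<forall>z. foldr pderiv_dir ds h differentiable (at z)))"

definition poly_fun1 :: "(complex \<Rightarrow> complex) \<Rightarrow> bool" where
  "poly_fun1 p \<longleftrightarrow> (\<exists>N c. p = (\<lambda>z. \<Sum>i\<le>N. c i * z ^ i))"

definition poly_fun2 :: "(complex \<times> complex \<Rightarrow> complex) \<Rightarrow> bool" where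
  "poly_fun2 p \<longleftrightarrow>
     (\<exists>N c. p = (\<lambda>(z, w). \<Sum>i\<le>N. \<Sum>j\<le>N. c i j * z ^ i * w ^ j))"

text \<open>Polynomial hulls: |p(z)| \<le> sup_K |p| for all polynomials p, with sup written out
  (so the hull of the empty set is empty).\<close>
definition poly_hull1 :: "complex set \<Rightarrow> complex set" where
  "poly_hull1 K = {z. \<forall>p M. poly_fun1 p \<longrightarrow> (\<forall>k\<in>K. norm (p k) \<le> M) \<longrightarrow> norm (p z) \<le> M}"

definition poly_hull2 :: "(complex \<times> complex) set \<Rightarrow> (complex \<times> complex) set" where
  "poly_hull2 K = {z. \<forall>p M. poly_fun2 p \<longrightarrow> (\<forall>k\<in>K. norm (p k) \<le> M) \<longrightarrow> norm (p z) \<le> M}"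

definition poly_convex1 :: "complex set \<Rightarrow> bool" where
  "poly_convex1 K \<longleftrightarrow> poly_hull1 K = K"

definition poly_convex2 :: "(complex \<times> complex) set \<Rightarrow> bool" where
  "poly_convex2 K \<longleftrightarrow> poly_hull2 K = K"

definition simply_coconnected :: "(complex \<times> complex) set \<Rightarrow> bool" where
  "simply_coconnected K \<longleftrightarrow>
     (\<forall>f :: complex \<times> complex \<Rightarrow> complex. continuous_on K f \<and> f ` K \<subseteq> - {0} \<longrightarrow>
          (\<exists>\<psi>. continuous_on K \<psi> \<and> (\<forall>x\<in>K. f x = exp (\<psi> x))))"

end

theory Submission
  imports Defs "HOL-Complex_Analysis.Complex_Analysis"
begin

text \<open>
  Let \<open>L\<close> be the projection of \<open>K\<close> to the first coordinate. For \<open>l \<notin> L\<close> consider the algebra of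
  polynomials, normed by the supremum over \<open>K\<close>, modulo \<open>z - l\<close>. Its quotient seminorm depends
  continuously on \<open>l\<close>, and an almost idempotent element has seminorm close to \<open>0\<close> or at
  least about \<open>1\<close>. Applied to the element \<open>1\<close> this shows that the set \<open>Y\<close> of all \<open>l\<close> with
  nonzero quotient is a union of components of the complement of \<open>L\<close>.

  Suppose \<open>Y\<close> is nonempty, fix \<open>a \<in> Y\<close>, and let \<open>\<psi>\<close> be a logarithm of \<open>z - a\<close> on \<open>K\<close>; it sorts
  the points of \<open>K\<close> into sheets. Let \<open>W\<close> be the interior of \<open>L \<union> Y\<close>. Since the curve \<open>h = 0\<close> is
  smooth, the points outside of \<open>L \<union> Y\<close> provide peaking functions \<open>1 / (z - b)\<close> at every frontier
  point of \<open>W\<close>, so for \<open>l \<in> W\<close> close to the frontier the seminorm only sees the part of \<open>K\<close>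
  near the fibre over \<open>l\<close>. As the fibres are polynomially convex, Runge's theorem gives polynomials
  in \<open>w\<close> which are almost idempotent there and almost equal to the indicator function of all
  sheets above a given one. Whether their seminorm is near \<open>0\<close> is locally constant in \<open>l\<close> and in
  the sheet, so the topmost sheet at which it is not defines a continuous logarithm of \<open>l - a\<close> on a
  collar of the frontier of \<open>W\<close>. This is impossible, as the collar surrounds \<open>a\<close>.

  Hence \<open>Y\<close> is empty, no point of the hull lies over the complement of \<open>L\<close>, and the peaking
  functions show that over points of \<open>L\<close> the hull has the same fibres as \<open>K\<close>.
\<close>

section \<open>Polynomials and uniform closures\<close>

lemma poly_fun1_iff: "poly_fun1 p \<longleftrightarrow> (\<exists>q. p = poly q)"
proof
  assume "poly_fun1 p"
  then obtain N c where p: "p = (\<lambda>z. \<Sum>i\<le>N. c i * z ^ i)"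
    unfolding poly_fun1_def by blast
  have "p = poly (\<Sum>i\<le>N. monom (c i) i)"
    unfolding p by (auto simp: poly_sum poly_monom)
  then show "\<exists>q. p = poly q" by blast
next
  assume "\<exists>q. p = poly q"
  then show "poly_fun1 p"
    unfolding poly_fun1_def using poly_altdef by blast
qed

text \<open>A polynomial in \<open>z, w\<close> is encoded as a polynomial in \<open>w\<close> with coefficients in \<open>\<complex>[z]\<close>.\<close>

lemma poly_fun2_iff:
  "poly_fun2 p \<longleftrightarrow> (\<exists>q :: complex poly poly. p = (\<lambda>(z, w). poly (poly q [:w:]) z))"
proof
  assume "poly_fun2 p"
  then obtain N c where p: "p = (\<lambda>(z, w). \<Sum>i\<le>N. \<Sum>j\<le>N. c i j * z ^ i * w ^ j)"
    unfolding poly_fun2_def by blast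
  have "poly (poly (monom (monom (c i j) i) j) [:w:]) z = c i j * z ^ i * w ^ j" for i j z w
    by (simp only: poly_monom poly_mult poly_power poly_pCons poly_0 mult_zero_right add_0_right)
  then have "p = (\<lambda>(z, w). poly (poly (\<Sum>i\<le>N. \<Sum>j\<le>N. monom (monom (c i j) i) j) [:w:]) z)"
    unfolding p poly_sum by simp
  then show "\<exists>q :: complex poly poly. p = (\<lambda>(z, w). poly (poly q [:w:]) z)" by blast
next
  assume "\<exists>q :: complex poly poly. p = (\<lambda>(z, w). poly (poly q [:w:]) z)"
  then obtain q :: "complex poly poly" where p: "p = (\<lambda>(z, w). poly (poly q [:w:]) z)" by blast
  \<comment> \<open>\<open>N\<close> bounds the degree in \<open>w\<close> and, through the sum over
    all coefficients, every degree in \<open>z\<close>; shorter sums are padded with zero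
    coefficients.\<close>
  define N where "N = degree q + (\<Sum>j\<le>degree q. degree (coeff q j))"
  have deg: "degree (coeff q j) \<le> N" for j
  proof (cases "j \<le> degree q")
    case True
    then have "degree (coeff q j) \<le> (\<Sum>j\<le>degree q. degree (coeff q j))"
      by (intro member_le_sum) auto
    then show ?thesis by (simp add: N_def)
  next
    case False
    then show ?thesis by (simp add: coeff_eq_0)
  qed
  have expand: "poly r x = (\<Sum>i\<le>n. coeff r i * x ^ i)" if "degree r \<le> n"
    for r :: "'b::comm_ring_1 poly" and x n
    unfolding poly_altdef by (rule sum.mono_neutral_left) (use that in \<open>auto simp: coeff_eq_0\<close>)
  have "p (z, w) = (\<Sum>i\<le>N. \<Sum>j\<le>N. coeff (coeff q j) i * z ^ i * w ^ j)" for z w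
  proof -
    have "p (z, w) = (\<Sum>j\<le>N. poly (coeff q j) z * w ^ j)"
      unfolding p by (simp add: expand[of q N] N_def poly_sum)
    also have "\<dots> = (\<Sum>j\<le>N. \<Sum>i\<le>N. coeff (coeff q j) i * z ^ i * w ^ j)"
      by (simp add: expand[OF deg] sum_distrib_right)
    finally show ?thesis by (subst sum.swap)
  qed
  then have "p = (\<lambda>(z, w). \<Sum>i\<le>N. \<Sum>j\<le>N. coeff (coeff q j) i * z ^ i * w ^ j)" by auto
  then show "poly_fun2 p"
    unfolding poly_fun2_def by (intro exI[of _ N] exI[of _ "\<lambda>i j. coeff (coeff q j) i"])
qed

lemma continuous_on_poly_fun2: "poly_fun2 p \<Longrightarrow> continuous_on S p"
  unfolding poly_fun2_def case_prod_beta by (auto intro!: continuous_intros)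

lemma continuous_on_poly_fun1: "poly_fun1 p \<Longrightarrow> continuous_on S p"
  unfolding poly_fun1_def by (auto intro!: continuous_intros)

text \<open>Polynomials in one variable and in two are both instances, so the closure arguments are
  carried out once.\<close>

locale fun_algebra =
  fixes P :: "('a \<Rightarrow> complex) set"
  assumes const: "(\<lambda>_. c) \<in> P"
    and add: "f \<in> P \<Longrightarrow> g \<in> P \<Longrightarrow> (\<lambda>x. f x + g x) \<in> P"
    and mult: "f \<in> P \<Longrightarrow> g \<in> P \<Longrightarrow> (\<lambda>x. f x * g x) \<in> P"
begin

lemma diff: "f \<in> P \<Longrightarrow> g \<in> P \<Longrightarrow> (\<lambda>x. f x - g x) \<in> P"
  using add[OF _ mult[OF const[of "-1"]], of f g] by simp

lemma sum: "(\<And>i. i \<in> I \<Longrightarrow> f i \<in> P) \<Longrightarrow> (\<lambda>x. \<Sum>i\<in>I. f i x) \<in> P"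
  by (induction I rule: infinite_finite_induct) (auto intro: add const)

lemma power: "f \<in> P \<Longrightarrow> (\<lambda>x. f x ^ n) \<in> P"
  by (induction n) (auto intro: mult const)

definition uclosure :: "'a set \<Rightarrow> ('a \<Rightarrow> complex) set" where
  "uclosure K = {f. \<forall>e>0. \<exists>p\<in>P. \<forall>x\<in>K. norm (f x - p x) < e}"

lemma uclosureI: "(\<And>e. e > 0 \<Longrightarrow> \<exists>p\<in>P. \<forall>x\<in>K. norm (f x - p x) < e) \<Longrightarrow> f \<in> uclosure K"
  by (simp add: uclosure_def)

lemma uclosureD: "f \<in> uclosure K \<Longrightarrow> e > 0 \<Longrightarrow> \<exists>p\<in>P. \<forall>x\<in>K. norm (f x - p x) < e"
  by (simp add: uclosure_def)

lemma uclosure_base: "f \<in> P \<Longrightarrow> f \<in> uclosure K"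
  by (auto simp: uclosure_def intro!: bexI[of _ f])

lemma uclosure_add:
  assumes "f \<in> uclosure K" "g \<in> uclosure K"
  shows "(\<lambda>x. f x + g x) \<in> uclosure K"
proof (rule uclosureI)
  fix e :: real assume "e > 0"
  obtain p where p: "p \<in> P" "\<forall>x\<in>K. norm (f x - p x) < e / 2"
    using uclosureD[OF assms(1), of "e / 2"] \<open>e > 0\<close> by auto
  obtain q where q: "q \<in> P" "\<forall>x\<in>K. norm (g x - q x) < e / 2"
    using uclosureD[OF assms(2), of "e / 2"] \<open>e > 0\<close> by auto
  have "norm (f x + g x - (p x + q x)) < e" if "x \<in> K" for x
    using norm_diff_triangle_ineq[of "f x" "g x" "p x" "q x"] p(2) q(2) that by fastforce
  then show "\<exists>p\<in>P. \<forall>x\<in>K. norm (f x + g x - p x) < e"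
    by (intro bexI[OF _ add[OF p(1) q(1)]]) auto
qed

lemma uclosure_cmult:
  assumes "f \<in> uclosure K"
  shows "(\<lambda>x. c * f x) \<in> uclosure K"
proof (rule uclosureI)
  fix e :: real assume "e > 0"
  have pos: "norm c + 1 > 0" by (simp add: add_nonneg_pos)
  obtain p where p: "p \<in> P" "\<forall>x\<in>K. norm (f x - p x) < e / (norm c + 1)"
    using uclosureD[OF assms, of "e / (norm c + 1)"] \<open>e > 0\<close> pos by auto
  have "norm (c * f x - c * p x) < e" if "x \<in> K" for x
  proof -
    have "norm (c * f x - c * p x) = norm c * norm (f x - p x)"
      by (simp add: norm_mult flip: right_diff_distrib)
    also have "\<dots> \<le> (norm c + 1) * norm (f x - p x)" by (simp add: mult_right_mono)
    also have "\<dots> < e" using p(2) that pos by (simp add: field_simps)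
    finally show ?thesis .
  qed
  then show "\<exists>p\<in>P. \<forall>x\<in>K. norm (c * f x - p x) < e"
    by (intro bexI[OF _ mult[OF const[of c] p(1)]]) auto
qed

lemma uclosure_sum:
  "(\<And>i. i \<in> I \<Longrightarrow> f i \<in> uclosure K) \<Longrightarrow> (\<lambda>x. \<Sum>i\<in>I. f i x) \<in> uclosure K"
  by (induction I rule: infinite_finite_induct) (auto intro: uclosure_add uclosure_base const)

lemma uclosure_uniform_limit:
  assumes "\<And>e. e > 0 \<Longrightarrow> \<exists>g\<in>uclosure K. \<forall>x\<in>K. norm (f x - g x) < e"
  shows "f \<in> uclosure K"
proof (rule uclosureI)
  fix e :: real assume "e > 0"
  obtain g where g: "g \<in> uclosure K" "\<forall>x\<in>K. norm (f x - g x) < e / 2"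
    using assms[of "e / 2"] \<open>e > 0\<close> by auto
  obtain q where q: "q \<in> P" "\<forall>x\<in>K. norm (g x - q x) < e / 2"
    using uclosureD[OF g(1), of "e / 2"] \<open>e > 0\<close> by auto
  have "norm (f x - q x) < e" if "x \<in> K" for x
    using norm_triangle_lt[of "f x - g x" "g x - q x" e] g(2) q(2) that by fastforce
  then show "\<exists>p\<in>P. \<forall>x\<in>K. norm (f x - p x) < e"
    using q(1) by (intro bexI[of _ q]) auto
qed

text \<open>The Neumann series for \<open>1 / (u g)\<close>, multiplied by \<open>g\<close>.\<close>

lemma uclosure_inverse:
  assumes u: "u \<in> P" and g: "g \<in> P" and bdd: "\<And>x. x \<in> K \<Longrightarrow> norm (g x) \<le> M"
    and \<theta>: "\<theta> < 1" "\<And>x. x \<in> K \<Longrightarrow> norm (1 - u x * g x) \<le> \<theta>"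
  shows "(\<lambda>x. 1 / u x) \<in> uclosure K"
proof (cases "K = {}")
  case True
  then show ?thesis using const by (auto simp: uclosure_def)
next
  case False
  then obtain x0 where "x0 \<in> K" by blast
  then have "0 \<le> \<theta>" "0 \<le> M" using \<theta>(2) bdd norm_ge_zero order_trans by metis+
  show ?thesis
  proof (rule uclosureI)
    fix e :: real assume "e > 0"
    \<comment> \<open>\<open>C\<close> bounds \<open>1 / u\<close> on \<open>K\<close>, because
      \<open>u * g\<close> has modulus at least \<open>1 - \<theta>\<close> and \<open>g\<close> at
      most \<open>M\<close>.\<close>
    define C where "C = M / (1 - \<theta>)"
    have "C \<ge> 0" using \<open>0 \<le> M\<close> \<theta>(1) by (simp add: C_def)
    obtain n where n: "\<theta> ^ n < e / (C + 1)"
      using real_arch_pow_inv[of "e / (C + 1)" \<theta>] \<open>e > 0\<close> \<open>C \<ge> 0\<close> \<theta>(1) by auto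
    have "norm (1 / u x - g x * (\<Sum>j<n. (1 - u x * g x) ^ j)) < e" if x: "x \<in> K" for x
    proof -
      define r where "r = 1 - u x * g x"
      have nr: "norm r \<le> \<theta>" using \<theta>(2)[OF x] by (simp add: r_def)
      have "1 \<le> norm r + norm (u x * g x)"
        using norm_triangle_ineq[of r "u x * g x"] by (simp add: r_def)
      then have ug: "1 - \<theta> \<le> norm (u x) * norm (g x)" using nr by (simp add: norm_mult)
      then have u0: "u x \<noteq> 0" and g0: "g x \<noteq> 0" using \<theta>(1) by auto
      have "(1 - r) * (\<Sum>j<n. r ^ j) = 1 - r ^ n"
        using one_diff_power_eq[of r n] by simp
      then have "u x * (g x * (\<Sum>j<n. r ^ j)) = 1 - r ^ n" by (simp add: r_def mult.assoc)
      then have "1 / u x - g x * (\<Sum>j<n. r ^ j) = r ^ n / u x"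
        using u0 by (simp add: field_simps)
      then have "norm (1 / u x - g x * (\<Sum>j<n. r ^ j)) = norm r ^ n * norm (1 / u x)"
        by (simp add: norm_power norm_divide)
      also have "norm (1 / u x) \<le> C"
      proof -
        have "1 - \<theta> \<le> norm (u x) * M" using ug bdd[OF x]
          by (meson mult_left_mono norm_ge_zero order_trans)
        then show ?thesis using u0 \<theta>(1) by (simp add: C_def norm_divide field_simps)
      qed
      then have "norm r ^ n * norm (1 / u x) \<le> \<theta> ^ n * (C + 1)"
        using nr \<open>0 \<le> \<theta>\<close> by (intro mult_mono power_mono) auto
      also have "\<dots> < e" using n \<open>C \<ge> 0\<close> by (simp add: field_simps)
      finally show ?thesis by (simp add: r_def)
    qed
    moreover have "(\<lambda>x. g x * (\<Sum>j<n. (1 - u x * g x) ^ j)) \<in> P"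
      by (intro mult g sum power diff const u)
    ultimately show "\<exists>p\<in>P. \<forall>x\<in>K. norm (1 / u x - p x) < e"
      by (intro bexI[of _ "\<lambda>x. g x * (\<Sum>j<n. (1 - u x * g x) ^ j)"]) auto
  qed
qed

text \<open>Riemann sums are finite combinations of the functions \<open>G t\<close>, hence lie in
  the closure; equicontinuity in \<open>t\<close>, uniform over \<open>K\<close>, makes them
  converge uniformly.\<close>

lemma uclosure_integral:
  assumes G: "\<And>t. t \<in> {0..1} \<Longrightarrow> G t \<in> uclosure K"
    and cont: "\<And>x. x \<in> K \<Longrightarrow> continuous_on {0..1::real} (\<lambda>t. G t x)"
    and equi: "\<And>e. e > 0 \<Longrightarrow> \<exists>d>0. \<forall>s\<in>{0..1}. \<forall>t\<in>{0..1}. \<forall>x\<in>K. \<bar>s - t\<bar> < d \<longrightarrow> norm (G s x - G t x) < e"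
  shows "(\<lambda>x. integral {0..1} (\<lambda>t. G t x)) \<in> uclosure K"
proof (rule uclosure_uniform_limit)
  fix e :: real assume "e > 0"
  then obtain d where "d > 0"
    and d: "\<And>s t x. s \<in> {0..1} \<Longrightarrow> t \<in> {0..1} \<Longrightarrow> x \<in> K \<Longrightarrow> \<bar>s - t\<bar> < d \<Longrightarrow> norm (G s x - G t x) < e / 2"
    using equi[of "e / 2"] by auto
  obtain n :: nat where n: "1 / d < real n" "n > 0"
    using reals_Archimedean2[of "1 / d"] \<open>d > 0\<close> by (metis divide_pos_pos gr0I less_irrefl of_nat_0 order_less_trans zero_less_one)
  have nd: "1 / real n < d" using n \<open>d > 0\<close> by (simp add: field_simps)
  define R where "R = (\<lambda>x. \<Sum>j<n. (1 / of_nat n) * G (real j / real n) x)"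
  have R: "R \<in> uclosure K" unfolding R_def
    by (intro uclosure_sum uclosure_cmult G) (use n in \<open>auto simp: field_simps\<close>)
  have "norm (integral {0..1} (\<lambda>t. G t x) - R x) < e" if x: "x \<in> K" for x
  proof -
    \<comment> \<open>Induction over the first \<open>k\<close> subintervals: each contributes an
      error of at most \<open>e / 2\<close> times its length \<open>1 / n\<close>.\<close>
    have "norm (integral {0..real k / real n} (\<lambda>t. G t x) -
        (\<Sum>j<k. (1 / of_nat n) * G (real j / real n) x)) \<le> real k / real n * (e / 2)"
      if "k \<le> n" for k using that
    proof (induction k)
      case 0
      then show ?case by simp
    next
      case (Suc k)
      define a b where "a = real k / real n" and "b = real (Suc k) / real n"
      have ab: "0 \<le> a" "a \<le> b" "b \<le> 1" "b - a = 1 / real n"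
        using Suc.prems n by (auto simp: a_def b_def field_simps)
      have cab: "continuous_on {c..d} (\<lambda>t. G t x)" if "0 \<le> c" "d \<le> 1" for c d
        using cont[OF x] continuous_on_subset that by fastforce
      have split: "integral {0..b} (\<lambda>t. G t x) = integral {0..a} (\<lambda>t. G t x) + integral {a..b} (\<lambda>t. G t x)"
        using Henstock_Kurzweil_Integration.integral_combine[OF ab(1,2) integrable_continuous_real[OF cab[of 0 b]]] ab
        by simp
      have const: "(1 / of_nat n) * G a x = integral {a..b} (\<lambda>t. G a x)"
        using ab by (simp add: scaleR_conv_of_real)
      have "norm (integral {a..b} (\<lambda>t. G t x) - (1 / of_nat n) * G a x) =
            norm (integral {a..b} (\<lambda>t. G t x - G a x))"
        unfolding const
        by (subst Henstock_Kurzweil_Integration.integral_diff)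
          (use ab in \<open>auto intro!: integrable_continuous_real cab\<close>)
      also have "\<dots> \<le> (e / 2) * (b - a)"
      proof (rule integral_bound)
        show "norm (G t x - G a x) \<le> e / 2" if "t \<in> {a..b}" for t
        proof -
          have "\<bar>t - a\<bar> < d" using that ab nd by auto
          then show ?thesis using that ab x by (intro less_imp_le d) auto
        qed
      qed (use ab in \<open>auto intro!: continuous_intros cab\<close>)
      finally have "norm (integral {a..b} (\<lambda>t. G t x) - (1 / of_nat n) * G a x) \<le> e / 2 * (1 / real n)"
        using ab by simp
      moreover have "norm (integral {0..a} (\<lambda>t. G t x) - (\<Sum>j<k. (1 / of_nat n) * G (real j / real n) x))
          \<le> real k / real n * (e / 2)"
        using Suc by (simp add: a_def)
      ultimately have "norm ((integral {0..a} (\<lambda>t. G t x) - (\<Sum>j<k. (1 / of_nat n) * G (real j / real n) x))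
         + (integral {a..b} (\<lambda>t. G t x) - (1 / of_nat n) * G a x)) \<le> real k / real n * (e / 2) + e / 2 * (1 / real n)"
        by (meson add_mono norm_triangle_le)
      moreover have "real k / real n * (e / 2) + e / 2 * (1 / real n) = b * (e / 2)"
        by (simp add: b_def field_simps add_divide_distrib)
      moreover have "(integral {0..a} (\<lambda>t. G t x) - (\<Sum>j<k. (1 / of_nat n) * G (real j / real n) x))
         + (integral {a..b} (\<lambda>t. G t x) - (1 / of_nat n) * G a x) =
         integral {0..b} (\<lambda>t. G t x) - (\<Sum>j<Suc k. (1 / of_nat n) * G (real j / real n) x)"
        unfolding split sum.lessThan_Suc a_def by (simp add: algebra_simps)
      ultimately show ?case unfolding b_def[symmetric] by (simp only:)
    qed
    from this[of n] have "norm (integral {0..1} (\<lambda>t. G t x) - R x) \<le> e / 2"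
      using n by (simp add: R_def)
    then show ?thesis using \<open>e > 0\<close> by linarith
  qed
  then show "\<exists>g\<in>uclosure K. \<forall>x\<in>K. norm (integral {0..1} (\<lambda>t. G t x) - g x) < e"
    by (intro bexI[OF _ R]) auto
qed

end

section \<open>The polynomial algebras in one and two variables\<close>

interpretation poly1: fun_algebra "Collect poly_fun1"
proof
  show "(\<lambda>_. c) \<in> Collect poly_fun1" for c
    unfolding poly_fun1_iff mem_Collect_eq by (rule exI[of _ "[:c:]"], rule ext, simp)
  show "(\<lambda>x. f x + g x) \<in> Collect poly_fun1" if "f \<in> Collect poly_fun1" "g \<in> Collect poly_fun1" for f g
  proof -
    from that obtain p q where "f = poly p" "g = poly q"
      unfolding poly_fun1_iff mem_Collect_eq by (elim exE)
    then have "(\<lambda>x. f x + g x) = poly (p + q)" by (intro ext) simp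
    then show ?thesis unfolding poly_fun1_iff mem_Collect_eq by (rule exI)
  qed
  show "(\<lambda>x. f x * g x) \<in> Collect poly_fun1" if "f \<in> Collect poly_fun1" "g \<in> Collect poly_fun1" for f g
  proof -
    from that obtain p q where "f = poly p" "g = poly q"
      unfolding poly_fun1_iff mem_Collect_eq by (elim exE)
    then have "(\<lambda>x. f x * g x) = poly (p * q)" by (intro ext) simp
    then show ?thesis unfolding poly_fun1_iff mem_Collect_eq by (rule exI)
  qed
qed

interpretation poly2: fun_algebra "Collect poly_fun2"
proof
  show "(\<lambda>_. c) \<in> Collect poly_fun2" for c
    unfolding poly_fun2_iff mem_Collect_eq by (rule exI[of _ "[:[:c:]:]"]) (simp add: fun_eq_iff)
  show "(\<lambda>x. f x + g x) \<in> Collect poly_fun2" if "f \<in> Collect poly_fun2" "g \<in> Collect poly_fun2" for f g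
  proof -
    from that obtain p q :: "complex poly poly"
      where "f = (\<lambda>(z, w). poly (poly p [:w:]) z)" "g = (\<lambda>(z, w). poly (poly q [:w:]) z)"
      unfolding poly_fun2_iff mem_Collect_eq by auto
    then have "(\<lambda>x. f x + g x) = (\<lambda>(z, w). poly (poly (p + q) [:w:]) z)" by auto
    then show ?thesis unfolding poly_fun2_iff mem_Collect_eq by blast
  qed
  show "(\<lambda>x. f x * g x) \<in> Collect poly_fun2" if "f \<in> Collect poly_fun2" "g \<in> Collect poly_fun2" for f g
  proof -
    from that obtain p q :: "complex poly poly"
      where "f = (\<lambda>(z, w). poly (poly p [:w:]) z)" "g = (\<lambda>(z, w). poly (poly q [:w:]) z)"
      unfolding poly_fun2_iff mem_Collect_eq by auto
    then have "(\<lambda>x. f x * g x) = (\<lambda>(z, w). poly (poly (p * q) [:w:]) z)" by auto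
    then show ?thesis unfolding poly_fun2_iff mem_Collect_eq by blast
  qed
qed

lemma poly_fun2_fst: "poly_fun2 fst"
  unfolding poly_fun2_iff by (rule exI[of _ "[:[:0, 1:]:]"]) (simp add: fun_eq_iff)

lemma poly_fun2_snd: "poly_fun2 snd"
  unfolding poly_fun2_iff by (rule exI[of _ "[:0, 1:]"]) (simp add: fun_eq_iff)

lemma poly_fun2_poly_snd:
  assumes "poly_fun1 p"
  shows "poly_fun2 (\<lambda>x. p (snd x))"
proof -
  obtain N c where p: "p = (\<lambda>z. \<Sum>i\<le>N. c i * z ^ i)"
    using assms unfolding poly_fun1_def by blast
  have "(\<lambda>x. \<Sum>i\<le>N. c i * snd x ^ i) \<in> Collect poly_fun2"
    by (intro poly2.sum poly2.mult poly2.const poly2.power) (simp add: poly_fun2_snd)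
  then show ?thesis by (simp add: p)
qed

section \<open>The quotient norm\<close>

text \<open>The quotient norm of \<open>f\<close> modulo \<open>(z - l) \<complex>[z, w]\<close>, where polynomials carry the sup norm on \<open>K\<close>.\<close>

definition qnorm :: "(complex \<times> complex) set \<Rightarrow> complex \<Rightarrow> (complex \<times> complex \<Rightarrow> complex) \<Rightarrow> real" where
  "qnorm K l f = Inf {M. 0 \<le> M \<and> (\<exists>g. poly_fun2 g \<and> (\<forall>k\<in>K. norm (f k - (fst k - l) * g k) \<le> M))}"

lemmas poly_fun2_const = poly2.const[unfolded mem_Collect_eq]
  and poly_fun2_add = poly2.add[unfolded mem_Collect_eq]
  and poly_fun2_mult = poly2.mult[unfolded mem_Collect_eq]
  and poly_fun2_diff = poly2.diff[unfolded mem_Collect_eq]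
  and poly_fun2_power = poly2.power[unfolded mem_Collect_eq]

lemmas poly_fun2_intros = poly_fun2_const poly_fun2_add poly_fun2_mult poly_fun2_diff
  poly_fun2_power poly_fun2_fst poly_fun2_snd

lemma poly_fun2_bounded:
  assumes "compact K" "poly_fun2 f"
  obtains F where "0 \<le> F" "\<And>k. k \<in> K \<Longrightarrow> norm (f k) \<le> F"
proof -
  have "bounded (f ` K)"
    using assms continuous_on_poly_fun2 compact_continuous_image compact_imp_bounded by blast
  then obtain B where "\<forall>y\<in>f ` K. norm y \<le> B" unfolding bounded_iff by blast
  then show ?thesis using that[of "max 0 B"] by (auto simp: le_max_iff_disj)
qed

lemma qnorm_le:
  assumes "0 \<le> M" "poly_fun2 g" "\<And>k. k \<in> K \<Longrightarrow> norm (f k - (fst k - l) * g k) \<le> M"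
  shows "qnorm K l f \<le> M"
  unfolding qnorm_def by (rule cInf_lower) (use assms in \<open>auto intro!: bdd_belowI[of _ 0]\<close>)

lemma qnorm_le_sup:
  assumes "0 \<le> M" "\<And>k. k \<in> K \<Longrightarrow> norm (f k) \<le> M"
  shows "qnorm K l f \<le> M"
  using qnorm_le[OF assms(1) poly_fun2_const[of 0]] assms(2) by simp

lemma qnorm_lessD:
  assumes "compact K" "poly_fun2 f" "qnorm K l f < M"
  obtains g where "poly_fun2 g" "\<And>k. k \<in> K \<Longrightarrow> norm (f k - (fst k - l) * g k) \<le> M"
proof -
  obtain F where F: "0 \<le> F" "\<And>k. k \<in> K \<Longrightarrow> norm (f k) \<le> F"
    using poly_fun2_bounded[OF assms(1,2)] by blast
  let ?S = "{M. 0 \<le> M \<and> (\<exists>g. poly_fun2 g \<and> (\<forall>k\<in>K. norm (f k - (fst k - l) * g k) \<le> M))}"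
  have "F \<in> ?S" using F poly_fun2_const[of 0] by (auto intro!: exI[of _ "\<lambda>_. 0"])
  then have "?S \<noteq> {}" by blast
  then obtain M' where "M' \<in> ?S" "M' < M"
    using assms(3) unfolding qnorm_def by (subst (asm) cInf_less_iff) (auto intro!: bdd_belowI[of _ 0])
  then obtain g where "poly_fun2 g" "\<forall>k\<in>K. norm (f k - (fst k - l) * g k) \<le> M'" by blast
  then show ?thesis using that[of g] \<open>M' < M\<close> by force
qed

lemma qnorm_nonneg:
  assumes "compact K" "poly_fun2 f"
  shows "0 \<le> qnorm K l f"
proof (rule ccontr)
  assume neg: "\<not> ?thesis"
  let ?S = "{M. 0 \<le> M \<and> (\<exists>g. poly_fun2 g \<and> (\<forall>k\<in>K. norm (f k - (fst k - l) * g k) \<le> M))}"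
  obtain F where F: "0 \<le> F" "\<And>k. k \<in> K \<Longrightarrow> norm (f k) \<le> F"
    using poly_fun2_bounded[OF assms] by blast
  then have "F \<in> ?S" using poly_fun2_const[of 0] by (auto intro!: exI[of _ "\<lambda>_. 0"])
  then have "0 \<le> Inf ?S" by (intro cInf_greatest) blast+
  then show False using neg by (simp add: qnorm_def)
qed

lemma qnorm_diff:
  assumes K: "compact K" and f: "poly_fun2 f" and g: "poly_fun2 g"
  shows "qnorm K l (\<lambda>k. f k - g k) \<le> qnorm K l f + qnorm K l g"
proof (rule field_le_epsilon)
  fix e :: real assume "e > 0"
  obtain u where u: "poly_fun2 u" "\<And>k. k \<in> K \<Longrightarrow> norm (f k - (fst k - l) * u k) \<le> qnorm K l f + e / 2"
    using qnorm_lessD[OF K f, of l "qnorm K l f + e / 2"] \<open>e > 0\<close> by auto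
  obtain v where v: "poly_fun2 v" "\<And>k. k \<in> K \<Longrightarrow> norm (g k - (fst k - l) * v k) \<le> qnorm K l g + e / 2"
    using qnorm_lessD[OF K g, of l "qnorm K l g + e / 2"] \<open>e > 0\<close> by auto
  show "qnorm K l (\<lambda>k. f k - g k) \<le> qnorm K l f + qnorm K l g + e"
  proof (rule qnorm_le)
    show "poly_fun2 (\<lambda>k. u k - v k)" by (intro poly_fun2_intros u v)
    show "norm (f k - g k - (fst k - l) * (u k - v k)) \<le> qnorm K l f + qnorm K l g + e" if "k \<in> K" for k
    proof -
      have "f k - g k - (fst k - l) * (u k - v k) = (f k - (fst k - l) * u k) - (g k - (fst k - l) * v k)"
        by (simp add: algebra_simps)
      also have "norm \<dots> \<le> (qnorm K l f + e / 2) + (qnorm K l g + e / 2)"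
        by (meson add_mono norm_triangle_le_diff u(2) v(2) that)
      finally show ?thesis by simp
    qed
  qed (use qnorm_nonneg[OF K f] qnorm_nonneg[OF K g] \<open>e > 0\<close> in \<open>auto intro!: add_nonneg_nonneg less_imp_le\<close>)
qed

text \<open>Multiplying representatives of two cosets modulo \<open>z - l\<close> gives a
  representative of the product coset, and sup norms are submultiplicative.\<close>

lemma qnorm_mult:
  assumes K: "compact K" and f: "poly_fun2 f" and g: "poly_fun2 g"
  shows "qnorm K l (\<lambda>k. f k * g k) \<le> qnorm K l f * qnorm K l g"
proof -
  define a b where "a = qnorm K l f" and "b = qnorm K l g"
  have "0 \<le> a" "0 \<le> b" by (auto simp: a_def b_def qnorm_nonneg K f g)
  have *: "qnorm K l (\<lambda>k. f k * g k) \<le> (a + e) * (b + e)" if "e > 0" for e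
  proof -
    obtain u where u: "poly_fun2 u" "\<And>k. k \<in> K \<Longrightarrow> norm (f k - (fst k - l) * u k) \<le> a + e"
      using qnorm_lessD[OF K f, of l "a + e"] \<open>e > 0\<close> by (auto simp: a_def)
    obtain v where v: "poly_fun2 v" "\<And>k. k \<in> K \<Longrightarrow> norm (g k - (fst k - l) * v k) \<le> b + e"
      using qnorm_lessD[OF K g, of l "b + e"] \<open>e > 0\<close> by (auto simp: b_def)
    show ?thesis
    proof (rule qnorm_le)
      show "poly_fun2 (\<lambda>k. u k * g k + f k * v k - (fst k - l) * (u k * v k))"
        by (intro poly_fun2_intros u v f g)
      show "norm (f k * g k - (fst k - l) * (u k * g k + f k * v k - (fst k - l) * (u k * v k)))
          \<le> (a + e) * (b + e)" if "k \<in> K" for k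
      proof -
        have "f k * g k - (fst k - l) * (u k * g k + f k * v k - (fst k - l) * (u k * v k))
            = (f k - (fst k - l) * u k) * (g k - (fst k - l) * v k)"
          by (simp add: algebra_simps)
        also have "norm \<dots> \<le> (a + e) * (b + e)"
          unfolding norm_mult by (intro mult_mono u v that) (use \<open>0 \<le> a\<close> \<open>e > 0\<close> in auto)
        finally show ?thesis .
      qed
    qed (use \<open>0 \<le> a\<close> \<open>0 \<le> b\<close> \<open>e > 0\<close> in auto)
  qed
  have "((\<lambda>e. (a + e) * (b + e)) \<longlongrightarrow> (a + 0) * (b + 0)) (at_right 0)"
    by (intro tendsto_intros)
  then have "qnorm K l (\<lambda>k. f k * g k) \<le> (a + 0) * (b + 0)"
    by (rule tendsto_lowerbound)
      (use * in \<open>auto simp: eventually_at_right_field intro!: exI[of _ 1]\<close>)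
  then show ?thesis by (simp add: a_def b_def)
qed

text \<open>A multiplier \<open>u\<close> that is nearly optimal at \<open>l\<close> is used again
  at \<open>l'\<close>. This costs \<open>(l - l') * u\<close>, and \<open>u\<close> is bounded
  because \<open>z - l\<close> stays away from \<open>0\<close> on \<open>K\<close>.\<close>

lemma qnorm_shift:
  assumes K: "compact K" and f: "poly_fun2 f" and F: "\<And>k. k \<in> K \<Longrightarrow> norm (f k) \<le> F" "0 \<le> F"
    and d: "d > 0" "\<And>k. k \<in> K \<Longrightarrow> d \<le> norm (fst k - l)"
  shows "qnorm K l' f \<le> qnorm K l f + norm (l - l') * (2 * F / d)"
proof (rule field_le_epsilon)
  fix e :: real assume "e > 0"
  \<comment> \<open>The slack \<open>e / c\<close> enters twice, directly and through the bound on
    \<open>u\<close>; the total is \<open>e / c * c = e\<close>.\<close>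
  define c where "c = 1 + norm (l - l') / d"
  have "c > 0" using d by (simp add: c_def add_pos_nonneg)
  define a where "a = qnorm K l f"
  have a: "0 \<le> a" "a \<le> F" by (auto simp: a_def qnorm_nonneg K f intro: qnorm_le_sup F)
  obtain u where u: "poly_fun2 u" "\<And>k. k \<in> K \<Longrightarrow> norm (f k - (fst k - l) * u k) \<le> a + e / c"
    using qnorm_lessD[OF K f, of l "a + e / c"] \<open>e > 0\<close> \<open>c > 0\<close> by (auto simp: a_def)
  have "qnorm K l' f \<le> (a + e / c) + norm (l - l') * ((F + (a + e / c)) / d)"
  proof (rule qnorm_le[OF _ u(1)])
    fix k assume k: "k \<in> K"
    have "norm ((fst k - l) * u k) \<le> norm (f k) + norm (f k - (fst k - l) * u k)"
      using norm_triangle_ineq4[of "f k" "f k - (fst k - l) * u k"] by simp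
    also have "\<dots> \<le> F + (a + e / c)" using F(1) u(2) k by (simp add: add_mono)
    finally have "norm (fst k - l) * norm (u k) \<le> F + (a + e / c)" by (simp add: norm_mult)
    then have "d * norm (u k) \<le> F + (a + e / c)"
      by (rule order_trans[OF mult_right_mono[OF d(2)[OF k] norm_ge_zero]])
    then have uk: "norm (u k) \<le> (F + (a + e / c)) / d" using d(1) by (simp add: field_simps)
    have "norm (f k - (fst k - l') * u k) = norm ((f k - (fst k - l) * u k) - (l - l') * u k)"
      by (simp add: algebra_simps)
    also have "\<dots> \<le> norm (f k - (fst k - l) * u k) + norm (l - l') * norm (u k)"
      by (metis norm_mult norm_triangle_ineq4)
    also have "\<dots> \<le> (a + e / c) + norm (l - l') * ((F + (a + e / c)) / d)"
      by (intro add_mono u(2) k mult_left_mono uk) auto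
    finally show "norm (f k - (fst k - l') * u k) \<le> (a + e / c) + norm (l - l') * ((F + (a + e / c)) / d)" .
  qed (use a F \<open>c > 0\<close> \<open>e > 0\<close> d in auto)
  also have "\<dots> = a + norm (l - l') * ((F + a) / d) + e / c * c"
  proof -
    have "(a + x) + t * ((F + (a + x)) / d) = a + t * ((F + a) / d) + x * (1 + t / d)" for x t
      by (simp add: add_divide_distrib algebra_simps)
    then show ?thesis unfolding c_def .
  qed
  also have "\<dots> \<le> a + norm (l - l') * ((F + F) / d) + e"
    using a d \<open>c > 0\<close> by (intro add_mono mult_left_mono divide_right_mono) auto
  finally show "qnorm K l' f \<le> qnorm K l f + norm (l - l') * (2 * F / d) + e" by (simp add: a_def)
qed

text \<open>Near a point off the projection of \<open>K\<close>, one lower bound for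
  \<open>z - l\<close> makes \<open>qnorm_shift\<close> applicable in both directions and gives a
  local Lipschitz estimate.\<close>

lemma continuous_on_qnorm:
  assumes K: "compact K" and f: "poly_fun2 f"
  shows "continuous_on (- fst ` K) (\<lambda>l. qnorm K l f)"
proof -
  obtain F where F: "0 \<le> F" "\<And>k. k \<in> K \<Longrightarrow> norm (f k) \<le> F"
    using poly_fun2_bounded[OF K f] by blast
  have "isCont (\<lambda>l. qnorm K l f) l" if l: "l \<in> - fst ` K" for l
  proof -
    have "compact (fst ` K)" by (intro compact_continuous_image K continuous_intros)
    then have "open (- fst ` K)" by (simp add: compact_imp_closed open_Compl)
    then obtain d where d: "d > 0" "ball l d \<subseteq> - fst ` K" using l open_contains_ball by blast
    have dist: "d / 2 \<le> norm (fst k - l')" if "k \<in> K" "norm (l' - l) < d / 2" for k l'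
    proof -
      have "d \<le> norm (fst k - l)" using d(2) that(1) by (force simp: dist_norm norm_minus_commute)
      moreover have "norm (fst k - l) \<le> norm (fst k - l') + norm (l' - l)"
        using norm_triangle_ineq[of "fst k - l'" "l' - l"] by simp
      ultimately show ?thesis using that(2) by linarith
    qed
    have "norm (qnorm K l' f - qnorm K l f) \<le> norm (l' - l) * (2 * F / (d / 2))" if "norm (l' - l) < d / 2" for l'
      using qnorm_shift[OF K f F(2,1), where d="d / 2" and l=l and l'=l'] qnorm_shift[OF K f F(2,1), where d="d / 2" and l=l' and l'=l]
        dist[OF _ that] dist[of _ l] d(1)
      by (force simp: norm_minus_commute abs_le_iff)
    then have "eventually (\<lambda>l'. norm (qnorm K l' f - qnorm K l f) \<le> norm (l' - l) * (2 * F / (d / 2))) (at l)"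
      unfolding eventually_at using d(1) by (auto intro!: exI[of _ "d / 2"] simp: dist_norm)
    moreover have "((\<lambda>l'. norm (l' - l) * (2 * F / (d / 2))) \<longlongrightarrow> norm (l - l) * (2 * F / (d / 2))) (at l)"
      by (intro tendsto_intros)
    then have "((\<lambda>l'. norm (l' - l) * (2 * F / (d / 2))) \<longlongrightarrow> 0) (at l)" by simp
    ultimately have "((\<lambda>l'. qnorm K l' f - qnorm K l f) \<longlongrightarrow> 0) (at l)"
      by (rule Lim_null_comparison)
    then show ?thesis unfolding isCont_def by (simp add: LIM_zero_iff)
  qed
  then show ?thesis by (simp add: continuous_at_imp_continuous_on)
qed

text \<open>The seminorm \<open>x\<close> satisfies \<open>x - x * x \<le> 1 / 16\<close>, whereas
  \<open>x - x * x\<close> is at least \<open>7 / 64\<close> between \<open>1 / 8\<close> and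
  \<open>7 / 8\<close>. The threshold \<open>1 / 2\<close> used below lies in this gap.\<close>

lemma qnorm_almost_idempotent:
  assumes K: "compact K" and q: "poly_fun2 q" and small: "qnorm K l (\<lambda>k. q k * q k - q k) \<le> 1 / 16"
  shows "qnorm K l q < 1 / 8 \<or> 7 / 8 < qnorm K l q"
proof -
  define x where "x = qnorm K l q"
  have "x = qnorm K l (\<lambda>k. q k * q k - (q k * q k - q k))" by (simp add: x_def)
  also have "\<dots> \<le> qnorm K l (\<lambda>k. q k * q k) + qnorm K l (\<lambda>k. q k * q k - q k)"
    by (intro qnorm_diff K poly_fun2_intros q)
  also have "\<dots> \<le> x * x + 1 / 16" unfolding x_def by (intro add_mono qnorm_mult K q small)
  finally have "x - x * x \<le> 1 / 16" by simp
  moreover have "x - x * x = 7 / 64 + (x - 1 / 8) * (7 / 8 - x)" by (simp add: field_simps)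
  ultimately have "(x - 1 / 8) * (7 / 8 - x) < 0" by linarith
  then show ?thesis unfolding x_def[symmetric] by (auto simp: mult_less_0_iff)
qed

text \<open>The two sides of the gap are \<open>3 / 4\<close> apart, so elements at distance at most
  \<open>1 / 2\<close> fall on the same side.\<close>

lemma qnorm_almost_idempotent_close:
  assumes K: "compact K" and p: "poly_fun2 p" and q: "poly_fun2 q"
    and "qnorm K l (\<lambda>k. p k * p k - p k) \<le> 1 / 16" "qnorm K l (\<lambda>k. q k * q k - q k) \<le> 1 / 16"
    and close: "qnorm K l (\<lambda>k. p k - q k) \<le> 1 / 2" "qnorm K l (\<lambda>k. q k - p k) \<le> 1 / 2"
  shows "1 / 2 < qnorm K l p \<longleftrightarrow> 1 / 2 < qnorm K l q"
proof -
  have "qnorm K l q = qnorm K l (\<lambda>k. p k - (p k - q k))" by simp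
  also have "\<dots> \<le> qnorm K l p + qnorm K l (\<lambda>k. p k - q k)"
    by (intro qnorm_diff K poly_fun2_intros p q)
  finally have 1: "qnorm K l q \<le> qnorm K l p + 1 / 2" using close by simp
  have "qnorm K l p = qnorm K l (\<lambda>k. q k - (q k - p k))" by simp
  also have "\<dots> \<le> qnorm K l q + qnorm K l (\<lambda>k. q k - p k)"
    by (intro qnorm_diff K poly_fun2_intros p q)
  finally have 2: "qnorm K l p \<le> qnorm K l q + 1 / 2" using close by simp
  show ?thesis
    using 1 2 qnorm_almost_idempotent[OF K p] qnorm_almost_idempotent[OF K q] assms(4,5) by force
qed

text \<open>The points off \<open>fst ` K\<close> at which \<open>z - l\<close> is not invertible in the uniform closure of the polynomials.\<close>

definition filled :: "(complex \<times> complex) set \<Rightarrow> complex set" where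
  "filled K = {l. l \<notin> fst ` K \<and> 1 / 2 < qnorm K l (\<lambda>_. 1)}"

text \<open>The element \<open>1\<close> is idempotent. With continuity this makes both
  \<open>filled K\<close> and its complement open off the projection of \<open>K\<close>.\<close>

lemma qnorm_one_neq_half:
  assumes "compact K"
  shows "qnorm K l (\<lambda>_. 1) \<noteq> 1 / 2"
proof -
  have "qnorm K l (\<lambda>k. 1 * 1 - 1) \<le> 1 / 16" by (rule qnorm_le_sup) auto
  then show ?thesis
    using qnorm_almost_idempotent[OF assms poly_fun2_const[of 1], of l] by auto
qed

lemma open_compl_fst:
  fixes K :: "('a::t2_space \<times> 'b::topological_space) set"
  shows "compact K \<Longrightarrow> open (- fst ` K)"
  by (intro open_Compl compact_imp_closed compact_continuous_image continuous_on_fst continuous_on_id)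

lemma open_filled:
  assumes "compact K"
  shows "open (filled K)"
proof -
  have "filled K = - fst ` K \<inter> (\<lambda>l. qnorm K l (\<lambda>_. 1)) -` {1 / 2 <..}"
    by (auto simp: filled_def)
  then show ?thesis
    using continuous_open_preimage[OF continuous_on_qnorm[OF assms poly_fun2_const] open_compl_fst[OF assms], of "{1 / 2 <..}"]
    by simp
qed

lemma open_compl_filled:
  assumes "compact K"
  shows "open (- (fst ` K \<union> filled K))"
proof -
  have "- (fst ` K \<union> filled K) = - fst ` K \<inter> (\<lambda>l. qnorm K l (\<lambda>_. 1)) -` {..<1 / 2}"
    using qnorm_one_neq_half[OF assms] by (force simp: filled_def)
  then show ?thesis
    using continuous_open_preimage[OF continuous_on_qnorm[OF assms poly_fun2_const] open_compl_fst[OF assms], of "{..<1 / 2}"]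
    by simp
qed

text \<open>Two disjoint open sets cover \<open>S\<close>, so membership in \<open>filled K\<close>
  cannot change within it.\<close>

lemma filled_connected:
  assumes "compact K" "connected S" "S \<inter> fst ` K = {}" "x \<in> S" "y \<in> S" "x \<in> filled K"
  shows "y \<in> filled K"
proof (rule ccontr)
  assume y: "y \<notin> filled K"
  have "S \<subseteq> filled K \<union> - (fst ` K \<union> filled K)" using assms(3) by blast
  moreover have "filled K \<inter> - (fst ` K \<union> filled K) \<inter> S = {}" by blast
  ultimately have "filled K \<inter> S = {} \<or> - (fst ` K \<union> filled K) \<inter> S = {}"
    using connectedD[OF assms(2) open_filled open_compl_filled] assms(1) by blast
  then show False using assms y by blast
qed

text \<open>A seminorm of \<open>1\<close> below \<open>3 / 4\<close> yields a polynomial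
  \<open>g\<close> for which \<open>1 - (z - b) * g\<close> is at most \<open>3 / 4\<close> on
  \<open>K\<close>, so the Neumann series applies. These inverses supply the peaking
  functions.\<close>

lemma uclosure_inverse_off_filled:
  assumes K: "compact K" and b: "b \<notin> fst ` K" "b \<notin> filled K"
  shows "(\<lambda>k. 1 / (fst k - b)) \<in> poly2.uclosure K"
proof -
  have "qnorm K b (\<lambda>_. 1) < 3 / 4" using b by (simp add: filled_def)
  then obtain g where g: "poly_fun2 g" "\<And>k. k \<in> K \<Longrightarrow> norm (1 - (fst k - b) * g k) \<le> 3 / 4"
    using qnorm_lessD[OF K poly_fun2_const[of 1]] by blast
  obtain F where "\<And>k. k \<in> K \<Longrightarrow> norm (g k) \<le> F"
    using poly_fun2_bounded[OF K g(1)] by blast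
  then show ?thesis
    using g by (intro poly2.uclosure_inverse[where g=g and \<theta>="3 / 4"]) (simp_all add: poly_fun2_intros)
qed

lemma bounded_filled:
  assumes "compact K"
  shows "bounded (filled K)"
proof -
  have "bounded (fst ` K)"
    by (intro compact_imp_bounded compact_continuous_image continuous_intros assms)
  then obtain B where B: "B > 0" "\<And>k. k \<in> K \<Longrightarrow> norm (fst k) \<le> B" unfolding bounded_pos by auto
  have "norm l \<le> 2 * B" if l: "l \<in> filled K" for l
  proof (rule ccontr)
    assume "\<not> ?thesis"
    then have nl: "2 * B < norm l" by simp
    then have l0: "l \<noteq> 0" using B(1) by auto
    have "qnorm K l (\<lambda>_. 1) \<le> 1 / 2"
    \<comment> \<open>For large \<open>l\<close> the constant \<open>- 1 / l\<close> is an
      approximate inverse of \<open>z - l\<close>; the remainder is \<open>z / l\<close>.\<close>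
    proof (rule qnorm_le[OF _ poly_fun2_const[of "- 1 / l"]])
      fix k assume "k \<in> K"
      have "1 - (fst k - l) * (- 1 / l) = fst k / l" using l0 by (simp add: field_simps)
      then show "norm (1 - (fst k - l) * (- 1 / l)) \<le> 1 / 2"
        using B(2)[OF \<open>k \<in> K\<close>] nl B(1) by (simp add: norm_divide divide_le_eq)
    qed auto
    then show False using l by (simp add: filled_def)
  qed
  then show ?thesis unfolding bounded_iff by blast
qed

text \<open>Modulo \<open>z - l\<close>, multiplication by the peaking function \<open>(l - b) / (z - b)\<close> does not change \<open>f\<close>.\<close>

lemma qnorm_localize:
  assumes K: "compact K" and b: "b \<notin> fst ` K" "b \<notin> filled K" and f: "poly_fun2 f" and "0 \<le> M"
    and M: "\<And>k. k \<in> K \<Longrightarrow> norm ((l - b) / (fst k - b) * f k) \<le> M"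
  shows "qnorm K l f \<le> M"
proof (rule field_le_epsilon)
  fix e :: real assume "e > 0"
  \<comment> \<open>This factor multiplies the error made in replacing \<open>1 / (z - b)\<close> by
    a polynomial, so its bound \<open>F\<close> fixes the accuracy required.\<close>
  have "poly_fun2 (\<lambda>k. (fst k - l) * f k)" by (intro poly_fun2_intros f)
  then obtain F where F: "0 \<le> F" "\<And>k. k \<in> K \<Longrightarrow> norm ((fst k - l) * f k) \<le> F"
    using poly_fun2_bounded[OF K] by blast
  obtain g where g: "poly_fun2 g" "\<And>k. k \<in> K \<Longrightarrow> norm (1 / (fst k - b) - g k) < e / (F + 1)"
    using poly2.uclosureD[OF uclosure_inverse_off_filled[OF K b], of "e / (F + 1)"] \<open>e > 0\<close> F(1) by auto
  show "qnorm K l f \<le> M + e"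
  proof (rule qnorm_le)
    show "poly_fun2 (\<lambda>k. g k * f k)" by (intro poly_fun2_intros g f)
    show "norm (f k - (fst k - l) * (g k * f k)) \<le> M + e" if k: "k \<in> K" for k
    proof -
      have "fst k - b \<noteq> 0" using b(1) k by force
      \<comment> \<open>With \<open>t = z - b\<close> and \<open>s = z - l\<close> one has
        \<open>t - s = l - b\<close>: the first summand is the peaking function times
        \<open>f\<close>, the second is the approximation error.\<close>
      moreover have "a - s * (c * a) = (t - s) / t * a + s * a * (1 / t - c)" if "t \<noteq> 0" for a s c t :: complex
        using that by (simp add: diff_divide_distrib algebra_simps)
      ultimately have "a - s * (c * a) = ((fst k - b) - s) / (fst k - b) * a + s * a * (1 / (fst k - b) - c)" for a s c
        by blast
      from this[of "f k" "fst k - l" "g k"] have "f k - (fst k - l) * (g k * f k) =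
          (l - b) / (fst k - b) * f k + (fst k - l) * f k * (1 / (fst k - b) - g k)"
        by simp
      also have "norm \<dots> \<le> M + F * (e / (F + 1))"
      proof (rule norm_triangle_mono)
        show "norm ((l - b) / (fst k - b) * f k) \<le> M" using M[OF k] by simp
        show "norm ((fst k - l) * f k * (1 / (fst k - b) - g k)) \<le> F * (e / (F + 1))"
          unfolding norm_mult[of "(fst k - l) * f k"]
          by (intro mult_mono F k less_imp_le[OF g(2)]) auto
      qed
      also have "F * (e / (F + 1)) \<le> e" using F(1) \<open>e > 0\<close> by (simp add: field_simps)
      finally show ?thesis by simp
    qed
  qed (use \<open>0 \<le> M\<close> \<open>e > 0\<close> in auto)
qed

section \<open>Separating the parts of a polynomially convex set\<close>

text \<open>Convexity provides \<open>p\<close> with \<open>norm (p t)\<close> above its bound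
  \<open>M\<close> on \<open>K\<close>. As \<open>1 - p / p t\<close> vanishes at \<open>t\<close>,
  it equals \<open>(w - t) * S\<close>, and \<open>S\<close> inverts \<open>w - t\<close> up to the
  error \<open>p / p t\<close>, which is bounded on \<open>K\<close> by
  \<open>M / norm (p t) < 1\<close>.\<close>

lemma poly_convex1_inverse_uclosure:
  assumes K: "compact K" "poly_convex1 K" and t: "t \<notin> K"
  shows "(\<lambda>w. 1 / (w - t)) \<in> poly1.uclosure K"
proof (cases "K = {}")
  case True
  then show ?thesis using poly1.const by (auto simp: poly1.uclosure_def)
next
  case False
  have "t \<notin> poly_hull1 K" using K(2) t by (simp add: poly_convex1_def)
  then obtain p M where p: "poly_fun1 p" "\<forall>k\<in>K. norm (p k) \<le> M" "M < norm (p t)"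
    by (auto simp: poly_hull1_def not_le)
  then have "0 \<le> M" using False norm_ge_zero order_trans by blast
  then have pt: "p t \<noteq> 0" using p(3) by auto
  obtain Q where Q: "p = poly Q" using p(1) by (auto simp: poly_fun1_iff)
  define R where "R = 1 - smult (1 / p t) Q"
  have "poly R t = 0" using pt by (simp add: R_def Q)
  then obtain S where S: "R = [:-t, 1:] * S" by (metis dvdE poly_eq_0_iff_dvd)
  have eq: "1 - (w - t) * poly S w = p w / p t" for w
  proof -
    have "poly R w = (w - t) * poly S w" by (simp add: S algebra_simps)
    then show ?thesis by (simp add: R_def Q diff_eq_eq add.commute)
  qed
  have pS: "poly S \<in> Collect poly_fun1" by (auto simp: poly_fun1_iff)
  have "bounded (poly S ` K)"
    using K(1) continuous_on_poly_fun1 compact_continuous_image compact_imp_bounded pS by blast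
  then obtain B where B: "\<And>w. w \<in> K \<Longrightarrow> norm (poly S w) \<le> B" unfolding bounded_iff by auto
  show ?thesis
  proof (rule poly1.uclosure_inverse[OF _ pS B])
    show "(\<lambda>w. w - t) \<in> Collect poly_fun1"
      unfolding mem_Collect_eq poly_fun1_iff by (intro exI[of _ "[:-t, 1:]"]) (simp add: fun_eq_iff)
    show "M / norm (p t) < 1" using p(3) pt by (simp add: divide_less_eq)
    show "norm (1 - (w - t) * poly S w) \<le> M / norm (p t)" if "w \<in> K" for w
      unfolding eq norm_divide using p(2) that by (simp add: divide_right_mono)
  qed
qed

text \<open>The integrand lies in the closure for each parameter, and since the segment keeps a
  positive distance from \<open>K\<close>, it is Lipschitz in the parameter uniformly over
  \<open>K\<close>.\<close>

lemma contour_integral_linepath_uclosure: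
  assumes K: "compact K" "poly_convex1 K" and seg: "closed_segment a b \<inter> K = {}"
  shows "(\<lambda>w. contour_integral (linepath a b) (\<lambda>t. 1 / (t - w))) \<in> poly1.uclosure K"
proof -
  obtain \<eta> where \<eta>: "\<eta> > 0" "\<And>x y. x \<in> closed_segment a b \<Longrightarrow> y \<in> K \<Longrightarrow> \<eta> \<le> dist x y"
    using separate_compact_closed[OF compact_segment compact_imp_closed[OF K(1)] seg] by blast
  have on_seg: "linepath a b t \<in> closed_segment a b" if "t \<in> {0..1}" for t
    using linepath_in_path[OF that] .
  define G where "G = (\<lambda>t w. (a - b) * (1 / (w - linepath a b t)))"
  have "(\<lambda>w. integral {0..1} (\<lambda>t. G t w)) \<in> poly1.uclosure K"
  proof (rule poly1.uclosure_integral)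
    show "G t \<in> poly1.uclosure K" if "t \<in> {0..1}" for t
      unfolding G_def
      by (intro poly1.uclosure_cmult poly_convex1_inverse_uclosure K) (use on_seg[OF that] seg in blast)
    show "continuous_on {0..1} (\<lambda>t. G t w)" if "w \<in> K" for w
      unfolding G_def
      by (intro continuous_intros continuous_on_linepath) (use on_seg seg that in fastforce)
    fix e :: real assume "e > 0"
    \<comment> \<open>The quotient is a Lipschitz constant of \<open>G\<close> in \<open>t\<close>;
      the summand \<open>1\<close> keeps \<open>L\<close> positive also when
      \<open>a = b\<close>.\<close>
    define L where "L = norm (b - a) * norm (b - a) / (\<eta> * \<eta>) + 1"
    have "L > 0" by (auto simp: L_def intro: add_nonneg_pos)
    show "\<exists>d>0. \<forall>s\<in>{0..1}. \<forall>t\<in>{0..1}. \<forall>w\<in>K. \<bar>s - t\<bar> < d \<longrightarrow> norm (G s w - G t w) < e"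
    proof (intro exI[of _ "e / L"] conjI ballI impI)
      fix s t w assume st: "s \<in> {0..1::real}" "t \<in> {0..1::real}" and w: "w \<in> K" and less: "\<bar>s - t\<bar> < e / L"
      define p q where "p = linepath a b s" and "q = linepath a b t"
      have p: "\<eta> \<le> norm (w - p)" and q: "\<eta> \<le> norm (w - q)"
        using \<eta>(2)[OF on_seg w] st by (auto simp: p_def q_def dist_norm norm_minus_commute)
      then have "w \<noteq> p" "w \<noteq> q" using \<eta>(1) by auto
      then have "G s w - G t w = (a - b) * (p - q) / ((w - p) * (w - q))"
        by (simp add: G_def p_def[symmetric] q_def[symmetric] field_simps)
      moreover have "p - q = (s - t) *\<^sub>R (b - a)"
        by (simp add: p_def q_def linepath_def algebra_simps)
      ultimately have "norm (G s w - G t w) = norm (b - a) * norm (b - a) * \<bar>s - t\<bar> / (norm (w - p) * norm (w - q))"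
        by (simp add: norm_mult norm_divide norm_minus_commute)
      also have "\<dots> \<le> norm (b - a) * norm (b - a) * \<bar>s - t\<bar> / (\<eta> * \<eta>)"
        using \<eta>(1) p q by (intro divide_left_mono mult_mono mult_pos_pos) auto
      also have "\<dots> \<le> L * \<bar>s - t\<bar>" by (simp add: L_def algebra_simps)
      also have "\<dots> < e" using less \<open>L > 0\<close> by (simp add: field_simps)
      finally show "norm (G s w - G t w) < e" .
    qed (use \<open>e > 0\<close> \<open>L > 0\<close> in auto)
  qed
  moreover have "contour_integral (linepath a b) (\<lambda>t. 1 / (t - w)) = integral {0..1} (\<lambda>t. G t w)" for w
  proof -
    have "G t w = (1 / (linepath a b t - w)) * (b - a)" for t
      unfolding G_def by (metis (no_types, lifting) divide_minus_left minus_diff_eq minus_divide_right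
        mult.commute mult_minus_left mult_minus_right minus_divide_divide)
    then show ?thesis by (simp add: contour_integral_integral)
  qed
  ultimately show ?thesis by simp
qed

text \<open>A Cauchy integral with density \<open>1\<close> is differentiable off its path. The
  continuity later transfers values to points on grid lines.\<close>

lemma isCont_contour_integral_linepath:
  assumes "w \<notin> closed_segment a b"
  shows "isCont (\<lambda>w. contour_integral (linepath a b) (\<lambda>t. 1 / (t - w))) w"
proof -
  have "((\<lambda>w. contour_integral (linepath a b) (\<lambda>t. 1 / (t - w))) has_field_derivative
      (of_nat 1 * contour_integral (linepath a b) (\<lambda>u. 1 / (u - w) ^ Suc 1))) (at w)"
  proof (rule Cauchy_next_derivative(2)[where S=UNIV and B="norm (b - a)" and f'="\<lambda>_. 1"])
    show "((\<lambda>u. 1 / (u - x) ^ 1) has_contour_integral contour_integral (linepath a b) (\<lambda>t. 1 / (t - x))) (linepath a b)"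
      if "x \<in> UNIV - path_image (linepath a b)" for x
      unfolding power_one_right
      by (intro has_contour_integral_integral contour_integrable_continuous_linepath continuous_intros)
        (use that in auto)
  qed (use assms in auto)
  then show ?thesis by (rule DERIV_isCont)
qed

text \<open>Cauchy's formula for the indicator function of \<open>A\<close>: cover \<open>A\<close> by the squares of a grid
  that is finer than the distance to \<open>B\<close>; the edges that do not cancel avoid \<open>A \<union> B\<close>.\<close>

lemma separating_polynomial:
  assumes A: "compact A" and B: "compact B" and disj: "A \<inter> B = {}"
    and conv: "poly_convex1 (A \<union> B)" and "0 < e"
  obtains q where "poly_fun1 q" "\<And>w. w \<in> A \<Longrightarrow> norm (q w - 1) < e" "\<And>w. w \<in> B \<Longrightarrow> norm (q w) < e"
proof -
  obtain d where d: "d > 0" "\<And>x y. x \<in> A \<Longrightarrow> y \<in> B \<Longrightarrow> d \<le> dist x y"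
    using separate_compact_closed[OF A compact_imp_closed[OF B] disj] by blast
  \<comment> \<open>Points of one square of side \<open>\<delta>\<close> are at distance at most
    \<open>2 * \<delta> < d\<close>, so no square meets both \<open>A\<close> and
    \<open>B\<close>.\<close>
  define \<delta> where "\<delta> = d / 3"
  have "\<delta> > 0" using d by (simp add: \<delta>_def)
  define v where "v = (\<lambda>i j. Complex (\<delta> * of_int i) (\<delta> * of_int j))"
  define sq where "sq = (\<lambda>p. cbox (v (fst p) (snd p)) (v (fst p + 1) (snd p + 1)))"
  have in_sq: "w \<in> sq (i, j) \<longleftrightarrow> \<delta> * of_int i \<le> Re w \<and> Re w \<le> \<delta> * (of_int i + 1) \<and>
      \<delta> * of_int j \<le> Im w \<and> Im w \<le> \<delta> * (of_int j + 1)" for w i j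
    by (auto simp: sq_def v_def in_cbox_complex_iff)
  have sq_dist: "dist x y < d" if "x \<in> sq p" "y \<in> sq p" for x y p
  proof -
    obtain i j where "p = (i, j)" by fastforce
    then have "\<bar>Re (x - y)\<bar> \<le> \<delta>" "\<bar>Im (x - y)\<bar> \<le> \<delta>"
      using that by (auto simp: in_sq algebra_simps)
    then show ?thesis using cmod_le[of "x - y"] d(1) by (simp add: dist_norm \<delta>_def)
  qed
  define Z where "Z = {p. sq p \<inter> A \<noteq> {}}"
  have "finite Z"
  proof -
    obtain R where R: "\<And>w. w \<in> A \<Longrightarrow> norm w \<le> R"
      using compact_imp_bounded[OF A] unfolding bounded_iff by blast
    define N where "N = \<lceil>R / \<delta>\<rceil> + 1"
    have "p \<in> {-N..N} \<times> {-N..N}" if pZ: "p \<in> Z" for p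
    proof -
      obtain i j where p: "p = (i, j)" by fastforce
      obtain w where w: "w \<in> A" "w \<in> sq (i, j)" using pZ by (auto simp: Z_def p)
      have "R / \<delta> \<le> of_int N - 1" by (simp add: N_def)
      then have "R \<le> \<delta> * of_int N - \<delta>" using \<open>\<delta> > 0\<close> by (simp add: field_simps)
      moreover have "\<bar>Re w\<bar> \<le> R" "\<bar>Im w\<bar> \<le> R"
        using R[OF w(1)] abs_Re_le_cmod abs_Im_le_cmod order_trans by blast+
      ultimately have "\<delta> * of_int i \<le> \<delta> * of_int N" "- (\<delta> * of_int N) \<le> \<delta> * of_int i"
        "\<delta> * of_int j \<le> \<delta> * of_int N" "- (\<delta> * of_int N) \<le> \<delta> * of_int j"
        using w(2) \<open>\<delta> > 0\<close> unfolding in_sq distrib_left by linarith+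
      then have "\<delta> * of_int i \<le> \<delta> * of_int N" "\<delta> * of_int (- N) \<le> \<delta> * of_int i"
        "\<delta> * of_int j \<le> \<delta> * of_int N" "\<delta> * of_int (- N) \<le> \<delta> * of_int j"
        by simp_all
      then have "i \<le> N" "- N \<le> i" "j \<le> N" "- N \<le> j"
        unfolding mult_le_cancel_left_pos[OF \<open>\<delta> > 0\<close>] of_int_le_iff by blast+
      then show ?thesis by (simp add: p)
    qed
    then show ?thesis by (meson finite_SigmaI finite_atLeastAtMost_int finite_subset subsetI)
  qed
  define I where "I = (\<lambda>a b w. contour_integral (linepath a b) (\<lambda>t. 1 / (t - w)))"
  \<comment> \<open>\<open>H p\<close> and \<open>V p\<close> belong to the lower and the left edge
    of the square \<open>p\<close>; its upper and right edges are the ones of \<open>up p\<close>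
    and \<open>right p\<close>.\<close>
  define H where "H = (\<lambda>p. I (v (fst p) (snd p)) (v (fst p + 1) (snd p)))"
  define V where "V = (\<lambda>p. I (v (fst p) (snd p)) (v (fst p) (snd p + 1)))"
  define up right :: "int \<times> int \<Rightarrow> int \<times> int" where "up = (\<lambda>p. (fst p, snd p + 1))" and "right = (\<lambda>p. (fst p + 1, snd p))"
  have inj: "inj up" "inj right" by (auto simp: inj_def up_def right_def prod_eq_iff)
  \<comment> \<open>One of the two squares misses \<open>A\<close>, which keeps the edge off
    \<open>A\<close>; the other meets \<open>A\<close>, so it is too small to reach
    \<open>B\<close>.\<close>
  have edge: "closed_segment a b \<inter> (A \<union> B) = {}"
    if pq: "p \<in> Z \<longleftrightarrow> q \<notin> Z" "closed_segment a b \<subseteq> sq p" "closed_segment a b \<subseteq> sq q" for p q a b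
  proof -
    have "closed_segment a b \<inter> A = {}" using pq by (auto simp: Z_def)
    moreover have "closed_segment a b \<inter> B = {}"
    proof (rule ccontr)
      assume "\<not> ?thesis"
      then obtain y where y: "y \<in> B" "y \<in> sq p" "y \<in> sq q" using pq by blast
      obtain x where "x \<in> A" "x \<in> sq p \<or> x \<in> sq q" using pq(1) by (auto simp: Z_def)
      then show False using y d(2)[of x y] sq_dist[of x _ y] by (metis not_le)
    qed
    ultimately show ?thesis by blast
  qed
  have hseg: "closed_segment (v i j) (v (i + 1) j) \<subseteq> sq (i, j)" "closed_segment (v i j) (v (i + 1) j) \<subseteq> sq (i, j - 1)"
    and vseg: "closed_segment (v i j) (v i (j + 1)) \<subseteq> sq (i, j)" "closed_segment (v i j) (v i (j + 1)) \<subseteq> sq (i - 1, j)" for i j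
    by (intro closed_segment_subset; simp add: in_sq v_def sq_def convex_box \<open>\<delta> > 0\<close> less_imp_le in_cbox_complex_iff algebra_simps)+
  have Hedge: "closed_segment (v i j) (v (i + 1) j) \<inter> (A \<union> B) = {}"
    if "(i, j) \<in> (Z - up ` Z) \<union> (up ` Z - Z)" for i j
  proof (rule edge[OF _ hseg])
    have "(i, j) \<in> up ` Z \<longleftrightarrow> (i, j - 1) \<in> Z"
      by (auto simp: up_def image_iff intro!: bexI[of _ "(i, j - 1)"])
    then show "((i, j) \<in> Z) = ((i, j - 1) \<notin> Z)" using that by blast
  qed
  have Vedge: "closed_segment (v i j) (v i (j + 1)) \<inter> (A \<union> B) = {}"
    if "(i, j) \<in> (Z - right ` Z) \<union> (right ` Z - Z)" for i j
  proof (rule edge[OF _ vseg])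
    have "(i, j) \<in> right ` Z \<longleftrightarrow> (i - 1, j) \<in> Z"
      by (auto simp: right_def image_iff intro!: bexI[of _ "(i - 1, j)"])
    then show "((i, j) \<in> Z) = ((i - 1, j) \<notin> Z)" using that by blast
  qed
  \<comment> \<open>The sum of the boundary integrals of all squares in \<open>Z\<close>, written
    without the edges that cancel; the remaining edges avoid \<open>A \<union> B\<close>.\<close>
  define \<Psi> where "\<Psi> = (\<lambda>w. 1 / (2 * pi * \<i>) * ((\<Sum>p\<in>Z - up ` Z. H p w) + (-1) * (\<Sum>p\<in>up ` Z - Z. H p w)
      + ((-1) * (\<Sum>p\<in>Z - right ` Z. V p w) + (\<Sum>p\<in>right ` Z - Z. V p w))))"
  have \<Psi>_uclosure: "\<Psi> \<in> poly1.uclosure (A \<union> B)"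
    unfolding \<Psi>_def H_def V_def I_def
    by (intro poly1.uclosure_cmult poly1.uclosure_add poly1.uclosure_sum
        contour_integral_linepath_uclosure conv compact_Un A B Hedge Vedge) auto
  have Hcont: "isCont (H p) w" if "p \<in> (Z - up ` Z) \<union> (up ` Z - Z)" "w \<in> A \<union> B" for p w
    unfolding H_def I_def
    by (rule isCont_contour_integral_linepath) (use that Hedge[of "fst p" "snd p"] in auto)
  have Vcont: "isCont (V p) w" if "p \<in> (Z - right ` Z) \<union> (right ` Z - Z)" "w \<in> A \<union> B" for p w
    unfolding V_def I_def
    by (rule isCont_contour_integral_linepath) (use that Vedge[of "fst p" "snd p"] in auto)
  have \<Psi>_cont: "isCont \<Psi> w" if "w \<in> A \<union> B" for w
    unfolding \<Psi>_def by (intro isCont_add isCont_mult isCont_sum continuous_const ballI Hcont Vcont that) auto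
  \<comment> \<open>In the interior of a grid square no grid line is met, so the uncancelled sum
    makes sense; each square contributes the winding number of its boundary.\<close>
  have \<Psi>_eq: "\<Psi> w = (if p0 \<in> Z then 1 else 0)"
    if p0: "p0 = (i0, j0)" and w: "\<delta> * of_int i0 < Re w" "Re w < \<delta> * (of_int i0 + 1)"
      "\<delta> * of_int j0 < Im w" "Im w < \<delta> * (of_int j0 + 1)" for w p0 i0 j0
  proof -
    have rect: "1 / (2 * pi * \<i>) * (H p w - H (up p) w + (V (right p) w - V p w)) = (if p = p0 then 1 else 0)" for p
    proof -
      obtain i j where p: "p = (i, j)" by fastforce
      let ?R = "rectpath (v i j) (v (i + 1) (j + 1))"
      let ?f = "\<lambda>t. 1 / (t - w)"
      have int_less: "\<delta> * of_int m < \<delta> * (of_int n + 1) \<Longrightarrow> m \<le> n" for m n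
      proof -
        assume "\<delta> * of_int m < \<delta> * (of_int n + 1)"
        then have "of_int m < (of_int (n + 1) :: real)" using \<open>\<delta> > 0\<close> by simp
        then show "m \<le> n" unfolding of_int_less_iff by simp
      qed
      have ne: "Re w \<noteq> \<delta> * of_int n" "Im w \<noteq> \<delta> * of_int n" for n
        using int_less[of n i0] int_less[of i0 "n - 1"] int_less[of n j0] int_less[of j0 "n - 1"] w by auto
      have hs: "w \<notin> closed_segment (v i j) (v (i + 1) j)" for i j
        using ne(2)[of j] subsetD[OF hseg(1)[of i j], of w] subsetD[OF hseg(2)[of i j], of w]
        by (force simp: in_sq)
      have vs: "w \<notin> closed_segment (v i j) (v i (j + 1))" for i j
        using ne(1)[of i] subsetD[OF vseg(1)[of i j], of w] subsetD[OF vseg(2)[of i j], of w]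
        by (force simp: in_sq)
      have cont: "continuous_on (closed_segment a b) ?f" if "w \<notin> closed_segment a b" for a b
        by (intro continuous_intros) (use that in auto)
      note hc = cont[OF hs] and vc = cont[OF vs]
      have hs': "w \<notin> closed_segment (v (i + 1) j) (v i j)" for i j
        using hs by (simp add: closed_segment_commute)
      have vs': "w \<notin> closed_segment (v i (j + 1)) (v i j)" for i j
        using vs by (simp add: closed_segment_commute)
      note hc' = cont[OF hs'] and vc' = cont[OF vs']
      have R: "?R = linepath (v i j) (v (i + 1) j) +++ linepath (v (i + 1) j) (v (i + 1) (j + 1)) +++
          linepath (v (i + 1) (j + 1)) (v i (j + 1)) +++ linepath (v i (j + 1)) (v i j)"
        by (simp add: rectpath_def v_def Let_def)
      have "contour_integral ?R ?f = contour_integral (linepath (v i j) (v (i + 1) j)) ?f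
          + (contour_integral (linepath (v (i + 1) j) (v (i + 1) (j + 1))) ?f
          + (contour_integral (linepath (v (i + 1) (j + 1)) (v i (j + 1))) ?f
          + contour_integral (linepath (v i (j + 1)) (v i j)) ?f))"
        unfolding R
        by (simp add: contour_integral_join contour_integrable_continuous_linepath contour_integrable_join
            valid_path_join hc vc hc' vc')
      also have "\<dots> = H p w - H (up p) w + (V (right p) w - V p w)"
        using contour_integral_reverse_linepath[OF hc'[of i "j + 1"]]
          contour_integral_reverse_linepath[OF vc'[of i j]]
        by (simp add: H_def V_def I_def up_def right_def p)
      finally have "1 / (2 * pi * \<i>) * (H p w - H (up p) w + (V (right p) w - V p w)) =
          1 / (2 * pi * \<i>) * contour_integral ?R ?f" by simp
      moreover have wR: "w \<notin> path_image ?R"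
        unfolding R using hs vs hs' vs' by (auto simp: path_image_join)
      ultimately have *: "1 / (2 * pi * \<i>) * (H p w - H (up p) w + (V (right p) w - V p w)) = winding_number ?R w"
        by (simp add: winding_number_valid_path)
      show ?thesis
      proof (cases "p = p0")
        case True
        then have "w \<in> box (v i j) (v (i + 1) (j + 1))"
          using w by (auto simp: p p0 in_box_complex_iff v_def)
        then show ?thesis using * True by (simp add: winding_number_rectpath)
      next
        case False
        have "w \<notin> cbox (v i j) (v (i + 1) (j + 1))"
        proof
          assume "w \<in> cbox (v i j) (v (i + 1) (j + 1))"
          then have wb: "w \<in> sq (i, j)" by (simp add: sq_def)
          have "\<delta> * of_int i < \<delta> * (of_int i0 + 1)" "\<delta> * of_int i0 < \<delta> * (of_int i + 1)"
            "\<delta> * of_int j < \<delta> * (of_int j0 + 1)" "\<delta> * of_int j0 < \<delta> * (of_int j + 1)"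
            using wb w unfolding in_sq by linarith+
          then have "i = i0" "j = j0" using int_less by (meson order_antisym)+
          then show False using False by (simp add: p p0)
        qed
        then show ?thesis using * False \<open>\<delta> > 0\<close>
          by (subst (asm) winding_number_rectpath_outside) (auto simp: v_def)
      qed
    qed
    \<comment> \<open>The edges common to \<open>Z\<close> and its shift cancel in the
      difference.\<close>
    have shift: "(\<Sum>p\<in>Z. F p) - (\<Sum>p\<in>Z. F (s p)) = (\<Sum>p\<in>Z - s ` Z. F p) - (\<Sum>p\<in>s ` Z - Z. F p)"
      if "inj s" for F :: "int \<times> int \<Rightarrow> complex" and s
    proof -
      have "(\<Sum>p\<in>Z. F (s p)) = (\<Sum>p\<in>s ` Z. F p)"
        using that by (simp add: sum.reindex inj_on_subset[OF that])
      moreover have "(\<Sum>p\<in>Z. F p) = (\<Sum>p\<in>Z - s ` Z. F p) + (\<Sum>p\<in>Z \<inter> s ` Z. F p)"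
        using sum.Int_Diff[OF \<open>finite Z\<close>, of F "s ` Z"] by simp
      moreover have "(\<Sum>p\<in>s ` Z. F p) = (\<Sum>p\<in>s ` Z - Z. F p) + (\<Sum>p\<in>Z \<inter> s ` Z. F p)"
        using sum.Int_Diff[of "s ` Z" F Z] \<open>finite Z\<close> by (simp add: Int_commute)
      ultimately show ?thesis by simp
    qed
    have "\<Psi> w = 1 / (2 * pi * \<i>) * (((\<Sum>p\<in>Z. H p w) - (\<Sum>p\<in>Z. H (up p) w)) + ((\<Sum>p\<in>Z. V (right p) w) - (\<Sum>p\<in>Z. V p w)))"
    proof -
      have "(\<Sum>p\<in>Z. V (right p) w) - (\<Sum>p\<in>Z. V p w) = (\<Sum>p\<in>right ` Z - Z. V p w) - (\<Sum>p\<in>Z - right ` Z. V p w)"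
        using shift[OF inj(2), of "\<lambda>p. V p w"] by (metis minus_diff_eq)
      then show ?thesis unfolding \<Psi>_def shift[OF inj(1), of "\<lambda>p. H p w"] by simp
    qed
    also have "\<dots> = (\<Sum>p\<in>Z. 1 / (2 * pi * \<i>) * (H p w - H (up p) w + (V (right p) w - V p w)))"
      by (simp only: sum_distrib_left[symmetric] sum.distrib sum_subtractf)
    also have "\<dots> = (\<Sum>p\<in>Z. if p = p0 then 1 else 0)" unfolding rect ..
    finally show ?thesis using \<open>finite Z\<close> by simp
  qed
  have \<Psi>_val: "\<Psi> w = (if w \<in> A then 1 else 0)" if w: "w \<in> A \<union> B" for w
  proof -
    \<comment> \<open>Since \<open>w\<close> may lie on a grid line, it is approached along the
      diagonal from the interior of this square, and continuity of \<open>\<Psi>\<close> gives the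
      value at \<open>w\<close>.\<close>
    define i0 j0 where "i0 = \<lfloor>Re w / \<delta>\<rfloor>" and "j0 = \<lfloor>Im w / \<delta>\<rfloor>"
    have "of_int i0 \<le> Re w / \<delta>" "Re w / \<delta> < of_int i0 + 1" "of_int j0 \<le> Im w / \<delta>" "Im w / \<delta> < of_int j0 + 1"
      unfolding i0_def j0_def by linarith+
    then have b: "\<delta> * of_int i0 \<le> Re w" "Re w < \<delta> * (of_int i0 + 1)" "\<delta> * of_int j0 \<le> Im w" "Im w < \<delta> * (of_int j0 + 1)"
      using \<open>\<delta> > 0\<close> by (auto simp: field_simps)
    then have wsq: "w \<in> sq (i0, j0)" by (simp add: in_sq)
    then have Z: "(i0, j0) \<in> Z \<longleftrightarrow> w \<in> A"
      using w d(2) sq_dist by (force simp: Z_def)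
    define \<epsilon>0 where "\<epsilon>0 = min (\<delta> * (of_int i0 + 1) - Re w) (\<delta> * (of_int j0 + 1) - Im w)"
    have "\<epsilon>0 > 0" using b by (simp add: \<epsilon>0_def)
    have "\<Psi> (w + Complex \<epsilon> \<epsilon>) = (if w \<in> A then 1 else 0)" if "0 < \<epsilon>" "\<epsilon> < \<epsilon>0" for \<epsilon>
      unfolding Z[symmetric] by (rule \<Psi>_eq) (use b that in \<open>auto simp: \<epsilon>0_def\<close>)
    then have "eventually (\<lambda>\<epsilon>. \<Psi> (w + Complex \<epsilon> \<epsilon>) = (if w \<in> A then 1 else 0)) (at_right 0)"
      unfolding eventually_at_right_field using \<open>\<epsilon>0 > 0\<close> by blast
    then have lim1: "((\<lambda>\<epsilon>. \<Psi> (w + Complex \<epsilon> \<epsilon>)) \<longlongrightarrow> (if w \<in> A then 1 else 0)) (at_right 0)"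
      by (rule tendsto_eventually)
    have "((\<lambda>\<epsilon>. w + Complex \<epsilon> \<epsilon>) \<longlongrightarrow> w + Complex 0 0) (at_right 0)"
      by (intro tendsto_intros)
    then have "((\<lambda>\<epsilon>. w + Complex \<epsilon> \<epsilon>) \<longlongrightarrow> w) (at_right 0)"
      by (simp flip: zero_complex.code)
    then have "((\<lambda>\<epsilon>. \<Psi> (w + Complex \<epsilon> \<epsilon>)) \<longlongrightarrow> \<Psi> w) (at_right 0)"
      by (rule isCont_tendsto_compose[OF \<Psi>_cont[OF w]])
    then show ?thesis using lim1 tendsto_unique[OF trivial_limit_at_right_real] by blast
  qed
  obtain q where q: "poly_fun1 q" "\<And>w. w \<in> A \<union> B \<Longrightarrow> norm (\<Psi> w - q w) < e"
    using poly1.uclosureD[OF \<Psi>_uclosure \<open>0 < e\<close>] by blast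
  show ?thesis
  proof (rule that[OF q(1)])
    show "norm (q w - 1) < e" if "w \<in> A" for w
      using q(2)[of w] \<Psi>_val[of w] that by (simp add: norm_minus_commute)
    show "norm (q w) < e" if "w \<in> B" for w
      using q(2)[of w] \<Psi>_val[of w] that disj by (auto split: if_splits)
  qed
qed

section \<open>Access to the curve from both sides\<close>

text \<open>A quantitative form of a regular zero, in place of a parametrization of the curve.
  Negating \<open>g\<close> and \<open>n\<close> exchanges the two sides.\<close>

definition chart :: "(complex \<Rightarrow> real) \<Rightarrow> complex \<Rightarrow> real \<Rightarrow> real \<Rightarrow> real \<Rightarrow> complex \<Rightarrow> bool" where
  "chart g c r m M n \<longleftrightarrow> 0 < r \<and> 0 < m \<and> 0 < M \<and> norm n = 1 \<and> g c = 0 \<and>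
     (\<forall>x\<in>ball c r. \<forall>y\<in>ball c r. \<bar>g x - g y\<bar> \<le> M * norm (x - y)) \<and>
     (\<forall>z t. 0 \<le> t \<longrightarrow> z \<in> ball c r \<longrightarrow> z + t *\<^sub>R n \<in> ball c r \<longrightarrow> g z + m * t \<le> g (z + t *\<^sub>R n))"

lemma chartD:
  assumes "chart g c r m M n"
  shows "0 < r" "0 < m" "0 < M" "norm n = 1" "g c = 0"
    "\<And>x y. x \<in> ball c r \<Longrightarrow> y \<in> ball c r \<Longrightarrow> \<bar>g x - g y\<bar> \<le> M * norm (x - y)"
    "\<And>z t. 0 \<le> t \<Longrightarrow> z \<in> ball c r \<Longrightarrow> z + t *\<^sub>R n \<in> ball c r \<Longrightarrow> g z + m * t \<le> g (z + t *\<^sub>R n)"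
  using assms unfolding chart_def by blast+

lemma chart_minus:
  assumes "chart g c r m M n"
  shows "chart (\<lambda>z. - g z) c r m M (- n)"
proof -
  note C = chartD[OF assms]
  have "- g z + m * t \<le> - g (z + t *\<^sub>R (- n))"
    if "0 \<le> t" "z \<in> ball c r" "z + t *\<^sub>R (- n) \<in> ball c r" for z t
    using C(7)[OF that(1) that(3)] that(2) by simp
  moreover have "\<bar>- g x - - g y\<bar> \<le> M * norm (x - y)" if "x \<in> ball c r" "y \<in> ball c r" for x y
    using C(6)[OF that] by linarith
  ultimately show ?thesis using C(1-5) unfolding chart_def by simp
qed

text \<open>The direction \<open>n\<close> is the normalized gradient at \<open>c\<close>. Near
  \<open>c\<close> the partial derivatives are almost constant by continuity, and mean value
  estimates give both bounds.\<close>

lemma smooth_real_chart: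
  assumes h: "smooth_real h" and c: "h c = 0" and nz: "frechet_derivative h (at c) \<noteq> (\<lambda>_. 0)"
  obtains r m M n where "chart h c r m M n"
proof -
  define D where "D = (\<lambda>z. frechet_derivative h (at z))"
  have "h differentiable (at z)" for z
    using h[unfolded smooth_real_def, rule_format, of "[]"] by simp
  then have D: "(h has_derivative D z) (at z)" for z
    unfolding D_def by (simp flip: frechet_derivative_works)
  define p q where "p = (\<lambda>z. D z 1)" and "q = (\<lambda>z. D z \<i>)"
  have "p differentiable (at z)" "q differentiable (at z)" for z
    using h[unfolded smooth_real_def, rule_format, of "[1]"] h[unfolded smooth_real_def, rule_format, of "[\<i>]"]
    by (simp_all add: p_def q_def D_def pderiv_dir_def[abs_def])
  then have cont: "isCont p z" "isCont q z" for z by (auto intro: differentiable_imp_continuous_within)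
  have Dv: "D z v = Re v * p z + Im v * q z" for z v
  proof -
    interpret linear "D z" using D has_derivative_linear by blast
    have "v = Re v *\<^sub>R 1 + Im v *\<^sub>R \<i>" by (simp add: complex_eq_iff)
    then have "D z v = D z (Re v *\<^sub>R 1 + Im v *\<^sub>R \<i>)" by simp
    then show ?thesis unfolding add scale p_def q_def by simp
  qed
  define N where "N = Complex (p c) (q c)"
  have "N \<noteq> 0"
  proof
    assume "N = 0"
    then have "D c = (\<lambda>_. 0)" by (auto simp: Dv N_def complex_eq_iff)
    then show False using nz by (simp add: D_def)
  qed
  define a where "a = norm N"
  have "a > 0" using \<open>N \<noteq> 0\<close> by (simp add: a_def)
  define n where "n = (1 / a) *\<^sub>R N"
  have n1: "norm n = 1" using \<open>a > 0\<close> by (simp add: n_def a_def)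
  have Dn: "D c n = a"
  proof -
    have "D c n = (1 / a) * (p c * p c + q c * q c)"
      by (simp add: Dv n_def N_def field_simps add_divide_distrib)
    also have "p c * p c + q c * q c = a * a"
      by (simp add: a_def N_def cmod_def power2_eq_square)
    finally show ?thesis using \<open>a > 0\<close> by simp
  qed
  \<comment> \<open>Changes below \<open>a / 4\<close> in each partial alter the derivative along
    the unit vector \<open>n\<close> by at most \<open>a / 2\<close>, half of its value at
    \<open>c\<close>.\<close>
  obtain r1 where r1: "r1 > 0" "\<And>z. dist z c < r1 \<Longrightarrow> dist (p z) (p c) < a / 4"
    using cont(1)[of c] \<open>a > 0\<close> unfolding continuous_at by (metis divide_pos_pos zero_less_numeral continuous_at continuous_at_eps_delta)
  obtain r2 where r2: "r2 > 0" "\<And>z. dist z c < r2 \<Longrightarrow> dist (q z) (q c) < a / 4"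
    using cont(2)[of c] \<open>a > 0\<close> unfolding continuous_at by (metis divide_pos_pos zero_less_numeral continuous_at continuous_at_eps_delta)
  define r where "r = min r1 r2"
  have near: "\<bar>p z - p c\<bar> < a / 4" "\<bar>q z - q c\<bar> < a / 4" if "z \<in> ball c r" for z
    using r1(2)[of z] r2(2)[of z] that by (auto simp: r_def dist_commute[of z] dist_real_def)
  have n_le: "\<bar>Re n\<bar> \<le> 1" "\<bar>Im n\<bar> \<le> 1" using abs_Re_le_cmod[of n] abs_Im_le_cmod[of n] n1 by auto
  have lower: "a / 2 \<le> D z n" if "z \<in> ball c r" for z
  proof -
    have "D c n - D z n = Re n * (p c - p z) + Im n * (q c - q z)" by (simp add: Dv algebra_simps)
    also have "\<dots> \<le> \<bar>Re n\<bar> * \<bar>p c - p z\<bar> + \<bar>Im n\<bar> * \<bar>q c - q z\<bar>"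
      by (metis abs_mult abs_ge_self add_mono)
    also have "\<dots> \<le> 1 * (a / 4) + 1 * (a / 4)"
      using near[OF that] n_le by (intro add_mono mult_mono) (auto simp: abs_minus_commute less_imp_le)
    finally show ?thesis using Dn by simp
  qed
  define M where "M = \<bar>p c\<bar> + \<bar>q c\<bar> + a"
  have "M > 0" using \<open>a > 0\<close> by (simp add: M_def)
  have upper: "\<bar>D z v\<bar> \<le> M * norm v" if "z \<in> ball c r" for z v
  proof -
    have "\<bar>D z v\<bar> \<le> \<bar>Re v\<bar> * \<bar>p z\<bar> + \<bar>Im v\<bar> * \<bar>q z\<bar>"
      unfolding Dv by (metis abs_mult abs_triangle_ineq)
    also have "\<dots> \<le> norm v * \<bar>p z\<bar> + norm v * \<bar>q z\<bar>"
      by (intro add_mono mult_right_mono abs_Re_le_cmod abs_Im_le_cmod) auto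
    also have "\<dots> = (\<bar>p z\<bar> + \<bar>q z\<bar>) * norm v" by (simp add: algebra_simps)
    also have "\<dots> \<le> M * norm v"
    proof (rule mult_right_mono)
      show "\<bar>p z\<bar> + \<bar>q z\<bar> \<le> M" using near[OF that] \<open>a > 0\<close> unfolding M_def by linarith
    qed simp
    finally show ?thesis .
  qed
  have "chart h c r (a / 2) M n"
    unfolding chart_def
  proof (intro conjI ballI allI impI)
    show "\<bar>h x - h y\<bar> \<le> M * norm (x - y)" if "x \<in> ball c r" "y \<in> ball c r" for x y
    proof -
      have "norm (h x - h y) \<le> M * norm (x - y)"
      proof (rule differentiable_bound[OF convex_ball _ _ that])
        show "(h has_derivative D z) (at z within ball c r)" for z by (rule has_derivative_at_withinI[OF D])
        show "onorm (D z) \<le> M" if "z \<in> ball c r" for z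
          by (rule onorm_bound) (use upper[OF that] \<open>M > 0\<close> in auto)
      qed
      then show ?thesis by simp
    qed
    show "h z + a / 2 * t \<le> h (z + t *\<^sub>R n)"
      if "0 \<le> t" and z: "z \<in> ball c r" and zt: "z + t *\<^sub>R n \<in> ball c r" for z t
    proof (cases "t = 0")
      case False
      then have "0 < t" using that by simp
      have "((\<lambda>s. h (z + s *\<^sub>R n)) has_derivative (\<lambda>u. D (z + s *\<^sub>R n) (u *\<^sub>R n))) (at s within {0..t})" for s
        by (rule has_derivative_compose[OF _ D]) (auto intro!: derivative_eq_intros)
      then obtain s where s: "s \<in> {0<..<t}" "h (z + t *\<^sub>R n) - h (z + 0 *\<^sub>R n) = D (z + s *\<^sub>R n) ((t - 0) *\<^sub>R n)"
        using mvt_simple[OF \<open>0 < t\<close>, of "\<lambda>s. h (z + s *\<^sub>R n)" "\<lambda>s u. D (z + s *\<^sub>R n) (u *\<^sub>R n)"] by blast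
      have "z + s *\<^sub>R n = (1 - s / t) *\<^sub>R z + (s / t) *\<^sub>R (z + t *\<^sub>R n)"
        using \<open>0 < t\<close> by (simp add: algebra_simps)
      also have "\<dots> \<in> ball c r"
        using convexD_alt[OF convex_ball z zt, of "s / t"] s(1) by simp
      finally have "t * (a / 2) \<le> t * D (z + s *\<^sub>R n) n" using lower \<open>0 < t\<close> by simp
      also have "\<dots> = D (z + s *\<^sub>R n) ((t - 0) *\<^sub>R n)" by (simp add: Dv algebra_simps)
      finally show ?thesis using s(2) by (simp add: mult.commute)
    qed simp
  qed (use \<open>a > 0\<close> \<open>M > 0\<close> r1 r2 n1 c in \<open>auto simp: r_def\<close>)
  then show ?thesis by (rule that)
qed

text \<open>A point on the positive side is pushed along \<open>n\<close> by \<open>\<beta>\<close>,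
  where \<open>g\<close> only grows, and then moved along a segment to the hub
  \<open>P\<close>.\<close>

lemma chart_connect:
  assumes "chart g c r m M n"
  obtains r1 P where "0 < r1" "r1 \<le> r" "P \<in> ball c r" "0 < g P"
    "\<And>x. x \<in> ball c r1 \<Longrightarrow> 0 < g x \<Longrightarrow>
       \<exists>S. connected S \<and> x \<in> S \<and> P \<in> S \<and> S \<subseteq> {z \<in> ball c r. 0 < g z}"
proof -
  note C = chartD[OF assms]
  define \<beta> where "\<beta> = r / 2"
  \<comment> \<open>On \<open>ball c r1\<close> the values of \<open>g\<close> exceed
    \<open>- (m * \<beta>)\<close>, so moving by \<open>\<beta>\<close> along \<open>n\<close> makes
    them positive.\<close>
  define r1 where "r1 = min (r / 2) (m * \<beta> / M)"
  have "0 < \<beta>" "0 < r1" "r1 \<le> r / 2" using C by (auto simp: \<beta>_def r1_def)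
  have "M * r1 \<le> m * \<beta>" using C by (simp add: r1_def min_def field_simps)
  have in_ball: "x + s *\<^sub>R n \<in> ball c r" if "x \<in> ball c r1" "0 \<le> s" "s \<le> \<beta>" for x s
  proof -
    have "dist c (x + s *\<^sub>R n) \<le> dist c x + dist x (x + s *\<^sub>R n)" by (rule dist_triangle)
    also have "dist x (x + s *\<^sub>R n) = s" using C(4) that by (simp add: dist_norm)
    finally show ?thesis using that \<open>r1 \<le> r / 2\<close> by (simp add: \<beta>_def)
  qed
  have up: "0 < g (y + \<beta> *\<^sub>R n)" if y: "y \<in> ball c r1" for y
  proof -
    have yr: "y \<in> ball c r" using in_ball[OF y, of 0] \<open>0 < \<beta>\<close> by simp
    have "\<bar>g y - g c\<bar> \<le> M * norm (y - c)" using C(1,6) yr by simp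
    also have "\<dots> < M * r1" using y C(3) by (simp add: dist_norm norm_minus_commute)
    also have "\<dots> \<le> m * \<beta>" by fact
    finally have "- (m * \<beta>) < g y" using C(5) by simp
    moreover have "g y + m * \<beta> \<le> g (y + \<beta> *\<^sub>R n)"
      using C(7)[of \<beta> y] yr in_ball[OF y, of \<beta>] \<open>0 < \<beta>\<close> by simp
    ultimately show ?thesis by linarith
  qed
  define P where "P = c + \<beta> *\<^sub>R n"
  show ?thesis
  proof (rule that[of r1 P])
    show "P \<in> ball c r" unfolding P_def using in_ball[of c \<beta>] \<open>0 < r1\<close> \<open>0 < \<beta>\<close> by simp
    show "0 < g P" unfolding P_def using up[of c] \<open>0 < r1\<close> by simp
    fix x assume x: "x \<in> ball c r1" "0 < g x"
    have xr: "x \<in> ball c r" using in_ball[OF x(1), of 0] \<open>0 < \<beta>\<close> by simp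
    define A where "A = closed_segment x (x + \<beta> *\<^sub>R n)"
    define B where "B = closed_segment (x + \<beta> *\<^sub>R n) P"
    have "z \<in> ball c r \<and> 0 < g z" if zA: "z \<in> A" for z
    proof -
      obtain u where u: "0 \<le> u" "u \<le> 1" "z = (1 - u) *\<^sub>R x + u *\<^sub>R (x + \<beta> *\<^sub>R n)"
        using zA by (auto simp: A_def closed_segment_def)
      then have z: "z = x + (u * \<beta>) *\<^sub>R n" by (simp add: algebra_simps)
      have ub: "0 \<le> u * \<beta>" "u * \<beta> \<le> \<beta>" using u \<open>0 < \<beta>\<close> by (auto simp: mult_left_le_one_le)
      have zr: "z \<in> ball c r" unfolding z by (rule in_ball[OF x(1) ub])
      moreover have "g x + m * (u * \<beta>) \<le> g z" using C(7)[of "u * \<beta>" x] ub xr zr by (simp add: z)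
      moreover have "0 \<le> m * (u * \<beta>)" using C(2) ub by simp
      ultimately show ?thesis using x(2) by auto
    qed
    moreover have "z \<in> ball c r \<and> 0 < g z" if zB: "z \<in> B" for z
    proof -
      obtain u where u: "0 \<le> u" "u \<le> 1" "z = (1 - u) *\<^sub>R (x + \<beta> *\<^sub>R n) + u *\<^sub>R P"
        using zB by (auto simp: B_def closed_segment_def)
      define y where "y = (1 - u) *\<^sub>R x + u *\<^sub>R c"
      have "y \<in> ball c r1"
        unfolding y_def using convexD_alt[OF convex_ball x(1), of c u] u \<open>0 < r1\<close> by simp
      moreover have "z = y + \<beta> *\<^sub>R n" by (simp add: u(3) y_def P_def algebra_simps)
      ultimately show ?thesis using up in_ball[of y \<beta>] \<open>0 < \<beta>\<close> by auto
    qed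
    moreover have "connected (A \<union> B)"
      by (rule connected_Un) (auto simp: A_def B_def)
    ultimately show "\<exists>S. connected S \<and> x \<in> S \<and> P \<in> S \<and> S \<subseteq> {z \<in> ball c r. 0 < g z}"
      by (intro exI[of _ "A \<union> B"]) (auto simp: A_def B_def)
  qed (use \<open>0 < r1\<close> \<open>r1 \<le> r / 2\<close> C(1) in auto)
qed

lemma chart_zero_closure:
  assumes "chart g c r m M n" and x: "x \<in> ball c r" "g x = 0" and U: "open U" "x \<in> U"
  obtains y where "y \<in> U" "y \<in> ball c r" "0 < g y"
proof -
  note C = chartD[OF assms(1)]
  obtain e where e: "e > 0" "ball x e \<subseteq> U \<inter> ball c r"
    using U x(1) by (metis IntI open_Int open_ball open_contains_ball)
  define y where "y = x + (e / 2) *\<^sub>R n"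
  have "y \<in> ball x e" using e(1) C(4) by (simp add: y_def dist_norm)
  then have "y \<in> U" "y \<in> ball c r" using e(2) by auto
  moreover have "g x + m * (e / 2) \<le> g y"
    using C(7)[of "e / 2" x] e(1) x(1) \<open>y \<in> ball c r\<close> by (simp add: y_def)
  then have "0 < g y" using x(2) C(2) e(1) by (smt (verit) mult_pos_pos half_gt_zero)
  ultimately show ?thesis by (rule that)
qed

text \<open>The value of \<open>g\<close> at \<open>b\<close> is at least \<open>m * t / 2\<close>
  while \<open>g\<close> vanishes on \<open>L\<close>, so the Lipschitz bound keeps \<open>L\<close>
  at a distance comparable to \<open>t\<close>. Thus \<open>(x - b) / (z - b)\<close> is bounded on
  \<open>L\<close> independently of \<open>t\<close>.\<close>

lemma chart_access:
  assumes "chart g c r m M n" and L: "L \<subseteq> {z. g z = 0}"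
    and x: "x \<in> ball c (r / 4)" "g x \<le> 0" and t: "0 < t" "t \<le> r / 4" "- g x \<le> m * t / 2"
    and b: "b = x + t *\<^sub>R n"
  shows "b \<in> ball c r" "0 < g b" "norm (x - b) = t" "\<And>l. l \<in> L \<Longrightarrow> norm (x - b) \<le> (1 + 2 * M / m) * norm (b - l)"
proof -
  note C = chartD[OF assms(1)]
  show tb: "norm (x - b) = t" using C(4) t by (simp add: b)
  have bc: "norm (b - c) \<le> r / 2"
    using norm_triangle_ineq[of "b - x" "x - c"] tb x(1) t(2) by (simp add: dist_norm norm_minus_commute)
  show br: "b \<in> ball c r" using bc C(1) by (simp add: dist_norm norm_minus_commute)
  have "x \<in> ball c r" using x(1) C(1) by simp
  then have "g x + m * t \<le> g b" using C(7)[of t x] t(1) br by (simp add: b)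
  then have gb: "m * t / 2 \<le> g b" using t(3) by linarith
  moreover have "0 < m * t / 2" using C(2) t(1) by simp
  ultimately show "0 < g b" by linarith
  fix l assume l: "l \<in> L"
  show "norm (x - b) \<le> (1 + 2 * M / m) * norm (b - l)"
  proof (cases "l \<in> ball c r")
    case True
    have "m * t / 2 \<le> \<bar>g b - g l\<bar>" using l L gb by auto
    also have "\<dots> \<le> M * norm (b - l)" using C(6) br True by blast
    finally have "t \<le> 2 * M / m * norm (b - l)" using C(2) by (simp add: field_simps)
    then show ?thesis using tb by (simp add: distrib_right add_increasing)
  next
    case False
    then have "r \<le> norm (l - c)" by (simp add: dist_norm norm_minus_commute)
    also have "\<dots> \<le> norm (b - l) + norm (b - c)"
      using norm_triangle_ineq4[of "b - c" "b - l"] by (simp add: add.commute)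
    finally have "t \<le> norm (b - l)" using bc t(2) C(1) by linarith
    also have "\<dots> \<le> (1 + 2 * M / m) * norm (b - l)"
      using C(2,3) by (simp add: distrib_right)
    finally show ?thesis using tb by simp
  qed
qed

text \<open>Near a frontier point of \<open>W\<close>, the set \<open>W\<close> lies on one side of the curve and the
  other side avoids \<open>fst ` K \<union> filled K\<close>.\<close>

lemma frontier_access_local:
  assumes K: "compact K" and L: "fst ` K \<subseteq> {z. h z = 0}"
    and charts: "\<And>c. h c = 0 \<Longrightarrow> \<exists>r m M n. chart h c r m M n"
    and W: "W = interior (fst ` K \<union> filled K)" and c: "c \<in> frontier W"
  obtains C r where "0 < r"
    "\<And>x. x \<in> W \<Longrightarrow> x \<in> ball c r \<Longrightarrow> x \<in> filled K \<and>
      (\<exists>b. b \<notin> fst ` K \<and> b \<notin> filled K \<and> (\<forall>l\<in>fst ` K. norm (x - b) \<le> C * norm (b - l)) \<and>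
        norm (x - b) \<le> C * infdist x (- W))"
proof -
  have "open W" by (simp add: W)
  have filledW: "filled K \<subseteq> W"
    unfolding W by (intro interior_maximal open_filled K) blast
  have W_sub: "W \<subseteq> fst ` K \<union> filled K" unfolding W by (rule interior_subset)
  have c_cl: "c \<in> closure W" and cW: "c \<notin> W"
    using c \<open>open W\<close> by (auto simp: frontier_def interior_open)
  have "closed (fst ` K \<union> filled K)" using open_compl_filled[OF K] by (simp add: closed_def)
  then have "closure W \<subseteq> fst ` K \<union> filled K" using W_sub by (simp add: closure_minimal)
  then have "c \<in> fst ` K" using c_cl cW filledW by blast
  then have "h c = 0" using L by blast
  then obtain r0 m0 M0 n0 where chart0: "chart h c r0 m0 M0 n0" using charts by blast
  obtain rp Pp where rp: "0 < rp" "rp \<le> r0"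
    "\<And>x. x \<in> ball c rp \<Longrightarrow> 0 < h x \<Longrightarrow> \<exists>S. connected S \<and> x \<in> S \<and> Pp \<in> S \<and> S \<subseteq> {z \<in> ball c r0. 0 < h z}"
    by (rule chart_connect[OF chart0]) (rule that; blast)
  obtain rm Pm where rm: "0 < rm" "rm \<le> r0"
    "\<And>x. x \<in> ball c rm \<Longrightarrow> 0 < - h x \<Longrightarrow> \<exists>S. connected S \<and> x \<in> S \<and> Pm \<in> S \<and> S \<subseteq> {z \<in> ball c r0. 0 < - h z}"
    by (rule chart_connect[OF chart_minus[OF chart0]]) (rule that; blast)
  define r1 where "r1 = min rp rm"
  have r1: "0 < r1" "r1 \<le> r0" using rp rm by (auto simp: r1_def)
  \<comment> \<open>Points on one side are joined through the hub \<open>Pp\<close> by a connected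
    set that misses the curve.\<close>
  have transfer_pos: "y \<in> filled K"
    if "x \<in> ball c r1" "y \<in> ball c r1" "0 < h x" "0 < h y" "x \<in> filled K" for x y
  proof -
    obtain S where S: "connected S" "x \<in> S" "Pp \<in> S" "S \<subseteq> {z \<in> ball c r0. 0 < h z}"
      using rp(3)[of x] \<open>x \<in> ball c r1\<close> \<open>0 < h x\<close> by (auto simp: r1_def)
    obtain T where T: "connected T" "y \<in> T" "Pp \<in> T" "T \<subseteq> {z \<in> ball c r0. 0 < h z}"
      using rp(3)[of y] \<open>y \<in> ball c r1\<close> \<open>0 < h y\<close> by (auto simp: r1_def)
    have "connected (S \<union> T)" using S T by (intro connected_Un) auto
    moreover have "h z \<noteq> 0" if "z \<in> S \<union> T" for z using that S(4) T(4) by auto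
    then have "(S \<union> T) \<inter> fst ` K = {}" using L by blast
    ultimately show ?thesis
      by (rule filled_connected[OF K _ _ _ _ \<open>x \<in> filled K\<close>]) (use S(2) T(2) in auto)
  qed
  have transfer_neg: "y \<in> filled K"
    if "x \<in> ball c r1" "y \<in> ball c r1" "0 < - h x" "0 < - h y" "x \<in> filled K" for x y
  proof -
    obtain S where S: "connected S" "x \<in> S" "Pm \<in> S" "S \<subseteq> {z \<in> ball c r0. 0 < - h z}"
      using rm(3)[of x] \<open>x \<in> ball c r1\<close> \<open>0 < - h x\<close> by (auto simp: r1_def)
    obtain T where T: "connected T" "y \<in> T" "Pm \<in> T" "T \<subseteq> {z \<in> ball c r0. 0 < - h z}"
      using rm(3)[of y] \<open>y \<in> ball c r1\<close> \<open>0 < - h y\<close> by (auto simp: r1_def)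
    have "connected (S \<union> T)" using S T by (intro connected_Un) auto
    moreover have "h z \<noteq> 0" if "z \<in> S \<union> T" for z using that S(4) T(4) by auto
    then have "(S \<union> T) \<inter> fst ` K = {}" using L by blast
    ultimately show ?thesis
      by (rule filled_connected[OF K _ _ _ _ \<open>x \<in> filled K\<close>]) (use S(2) T(2) in auto)
  qed
  obtain x1 where x1: "x1 \<in> W" "x1 \<in> ball c r1" "h x1 \<noteq> 0"
  proof -
    obtain x where x: "x \<in> W" "x \<in> ball c r1"
      using c_cl r1(1) closure_approachable by (metis dist_commute mem_ball)
    show ?thesis
    proof (cases "h x = 0")
      case True
      obtain y where "y \<in> W \<inter> ball c r1" "0 < h y"
        using chart_zero_closure[OF chart0, of x "W \<inter> ball c r1"] x True r1(2) \<open>open W\<close> by auto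
      then show ?thesis using that[of y] by auto
    qed (use that x in blast)
  qed
  then have x1f: "x1 \<in> filled K" using W_sub L by blast
  \<comment> \<open>\<open>g\<close> is \<open>h\<close> or \<open>- h\<close>, with the sign for
    which the point \<open>x1\<close> of \<open>W\<close> lies on the negative side.\<close>
  obtain g n where g: "chart g c r0 m0 M0 n" "\<And>z. g z = 0 \<longleftrightarrow> h z = 0" "g x1 < 0"
    "\<And>x y. x \<in> ball c r1 \<Longrightarrow> y \<in> ball c r1 \<Longrightarrow> 0 < g x \<Longrightarrow> 0 < g y \<Longrightarrow> x \<in> filled K \<Longrightarrow> y \<in> filled K"
    "\<And>x y. x \<in> ball c r1 \<Longrightarrow> y \<in> ball c r1 \<Longrightarrow> 0 < - g x \<Longrightarrow> 0 < - g y \<Longrightarrow> x \<in> filled K \<Longrightarrow> y \<in> filled K"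
  proof (cases "h x1 < 0")
    case True
    then show ?thesis using that[of h n0] chart0 transfer_pos transfer_neg by blast
  next
    case False
    then have x1neg: "- h x1 < 0" using x1(3) by auto
    show ?thesis
    proof (rule that[OF chart_minus[OF chart0]])
      show "y \<in> filled K"
        if "x \<in> ball c r1" "y \<in> ball c r1" "0 < - (- h x)" "0 < - (- h y)" "x \<in> filled K" for x y
        using transfer_pos[OF that(1,2) _ _ that(5)] that(3,4) by simp
    qed (use x1neg in \<open>auto intro: transfer_neg\<close>)
  qed
  note C = chartD[OF g(1)]
  have neg_filled: "x \<in> filled K" if "x \<in> ball c r1" "g x < 0" for x
    using g(5)[OF x1(2) that(1)] g(3) that(2) x1f by auto
  \<comment> \<open>As \<open>c\<close> is outside the interior \<open>W\<close>, such a point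
    exists; it turns out to lie on the positive side and forces that whole side off
    \<open>filled K\<close>.\<close>
  obtain b0 where b0: "b0 \<in> ball c r1" "b0 \<notin> fst ` K" "b0 \<notin> filled K"
  proof -
    have "\<not> ball c r1 \<subseteq> fst ` K \<union> filled K"
      using cW r1(1) interior_maximal[OF _ open_ball] unfolding W by (metis centre_in_ball subsetD)
    then show ?thesis using that by blast
  qed
  have "0 < g b0"
  proof (rule ccontr)
    assume "\<not> ?thesis"
    moreover have "\<not> g b0 < 0" using neg_filled b0 by blast
    ultimately have "- g b0 = 0" by simp
    then obtain y where "y \<in> - (fst ` K \<union> filled K) \<inter> ball c r1" "0 < - g y"
      using chart_zero_closure[OF chart_minus[OF g(1)], of b0 "- (fst ` K \<union> filled K) \<inter> ball c r1"]
        b0 r1(2) open_compl_filled[OF K] by auto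
    then show False using neg_filled[of y] by auto
  qed
  have pos_off: "x \<notin> fst ` K \<and> x \<notin> filled K" if "x \<in> ball c r1" "0 < g x" for x
    using g(4)[OF that(1) b0(1) that(2) \<open>0 < g b0\<close>] b0(3) g(2)[of x] that(2) L by auto
  have W_neg: "g x < 0" if xW: "x \<in> W" "x \<in> ball c r1" for x
  proof (rule ccontr)
    assume "\<not> ?thesis"
    moreover have "\<not> 0 < g x" using pos_off[OF that(2)] W_sub that(1) by blast
    ultimately have "g x = 0" by simp
    then obtain y where "y \<in> W \<inter> ball c r1" "0 < g y"
      using chart_zero_closure[OF g(1), of x "W \<inter> ball c r1"] xW r1(2) \<open>open W\<close> by auto
    then show False using pos_off[of y] W_sub by blast
  qed
  \<comment> \<open>The second entry makes the step length \<open>t\<close> below at most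
    \<open>r1 / 4\<close>, so that \<open>b\<close> stays in \<open>ball c r1\<close>, where the
    sides have been identified.\<close>
  define r' where "r' = min (r1 / 4) (m0 * r1 / (8 * M0))"
  have r': "0 < r'" "r' \<le> r1 / 4" "2 * M0 / m0 * r' \<le> r1 / 4"
    using r1 C(2,3) by (auto simp: r'_def min_def field_simps)
  show ?thesis
  proof (rule that[of r' "1 + 2 * M0 / m0"])
    show "0 < r'" by fact
    fix x assume x: "x \<in> W" "x \<in> ball c r'"
    have xr1: "x \<in> ball c r1" using x(2) r'(2) r1(1) by simp
    have gx: "g x < 0" using W_neg x(1) xr1 by blast
    have xf: "x \<in> filled K" using neg_filled xr1 gx by blast
    have "closed (- W)" "- W \<noteq> {}" using closed_Compl[OF \<open>open W\<close>] cW by auto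
    then obtain y where y: "y \<in> - W" "infdist x (- W) = dist x y"
      using infdist_attains_inf by metis
    \<comment> \<open>The nearest point \<open>y\<close> of \<open>- W\<close> is thus still in
      \<open>ball c r1\<close>, where it has \<open>g y \<ge> 0\<close>; this bounds
      \<open>- g x\<close> by \<open>M0\<close> times the distance to \<open>- W\<close>.\<close>
    have yx: "dist x y \<le> dist x c" using infdist_le[of c "- W" x] cW y(2) by simp
    have "dist c y \<le> dist c x + dist x y" by (rule dist_triangle)
    also have "\<dots> < r1" using yx x(2) r'(2) r1(1) by (simp add: dist_commute)
    finally have yr1: "y \<in> ball c r1" by simp
    have "0 \<le> g y"
      using neg_filled[OF yr1] filledW y(1) by force
    then have "- g x \<le> \<bar>g x - g y\<bar>" by linarith
    also have "\<dots> \<le> M0 * norm (x - y)" using C(6)[of x y] xr1 yr1 r1(2) by simp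
    finally have gM: "- g x \<le> M0 * infdist x (- W)" using y(2) by (simp add: dist_norm)
    \<comment> \<open>The length for which the last condition on \<open>t\<close> in
      \<open>chart_access\<close> is an equality.\<close>
    define t where "t = 2 * (- g x) / m0"
    define b where "b = x + t *\<^sub>R n"
    have "0 < t" using gx C(2) by (simp add: t_def divide_neg_pos)
    have tM: "t \<le> 2 * M0 / m0 * infdist x (- W)"
      using gM C(2) by (simp add: t_def field_simps)
    also have "\<dots> \<le> 2 * M0 / m0 * r'"
      using yx x(2) C(2,3) y(2) by (intro mult_left_mono) (auto simp: dist_commute)
    also have "\<dots> \<le> r1 / 4" by fact
    finally have t4: "t \<le> r1 / 4" .
    have "x \<in> ball c (r0 / 4)" "t \<le> r0 / 4" "- g x \<le> m0 * t / 2"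
      using x(2) r'(2) r1(2) t4 C(2) by (auto simp: t_def)
    note A = chart_access[OF g(1) _ this(1) less_imp_le[OF gx] \<open>0 < t\<close> this(2,3) b_def, of "fst ` K"]
    have Lg: "fst ` K \<subseteq> {z. g z = 0}" using L g(2) by blast
    have "norm (b - c) < r1"
      using norm_triangle_ineq[of "b - x" "x - c"] A(3)[OF Lg] t4 x(2) r'(2) r1(1)
      by (simp add: dist_norm norm_minus_commute)
    then have br1: "b \<in> ball c r1" by (simp add: dist_norm norm_minus_commute)
    have "2 * M0 / m0 * infdist x (- W) \<le> (1 + 2 * M0 / m0) * infdist x (- W)"
      by (intro mult_right_mono) (auto simp: infdist_nonneg)
    then have "norm (x - b) \<le> (1 + 2 * M0 / m0) * infdist x (- W)"
      using A(3)[OF Lg] tM by linarith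
    then show "x \<in> filled K \<and>
      (\<exists>b. b \<notin> fst ` K \<and> b \<notin> filled K \<and> (\<forall>l\<in>fst ` K. norm (x - b) \<le> (1 + 2 * M0 / m0) * norm (b - l)) \<and>
        norm (x - b) \<le> (1 + 2 * M0 / m0) * infdist x (- W))"
      using xf pos_off[OF br1] A(2)[OF Lg] A(4)[OF Lg] by blast
  qed
qed

text \<open>Otherwise bad points whose distance to \<open>- W\<close> tends to \<open>0\<close>
  accumulate at a frontier point, where \<open>frontier_access_local\<close> applies.\<close>

lemma frontier_access:
  assumes K: "compact K" and L: "fst ` K \<subseteq> {z. h z = 0}"
    and charts: "\<And>c. h c = 0 \<Longrightarrow> \<exists>r m M n. chart h c r m M n"
    and W: "W = interior (fst ` K \<union> filled K)"
  obtains C d where "0 < C" "0 < d"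
    "\<And>x. x \<in> W \<Longrightarrow> infdist x (- W) < d \<Longrightarrow> x \<in> filled K \<and>
      (\<exists>b. b \<notin> fst ` K \<and> b \<notin> filled K \<and> (\<forall>l\<in>fst ` K. norm (x - b) \<le> C * norm (b - l)) \<and>
        norm (x - b) \<le> C * infdist x (- W))"
proof -
  define Q where "Q = (\<lambda>C x. x \<in> filled K \<and>
      (\<exists>b. b \<notin> fst ` K \<and> b \<notin> filled K \<and> (\<forall>l\<in>fst ` K. norm (x - b) \<le> C * norm (b - l)) \<and>
        norm (x - b) \<le> C * infdist x (- W)))"
  have Q_mono: "Q C' x" if "Q C x" "C \<le> C'" for C C' x
  proof -
    obtain b where b: "b \<notin> fst ` K" "b \<notin> filled K" "\<forall>l\<in>fst ` K. norm (x - b) \<le> C * norm (b - l)"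
      "norm (x - b) \<le> C * infdist x (- W)" and xf: "x \<in> filled K"
      using \<open>Q C x\<close> unfolding Q_def by blast
    have "norm (x - b) \<le> C' * norm (b - l)" if "l \<in> fst ` K" for l
      using b(3) that \<open>C \<le> C'\<close> by (meson mult_right_mono norm_ge_zero order_trans)
    moreover have "norm (x - b) \<le> C' * infdist x (- W)"
      using b(4) \<open>C \<le> C'\<close> by (meson mult_right_mono infdist_nonneg order_trans)
    ultimately show ?thesis unfolding Q_def using b xf by blast
  qed
  have "open W" by (simp add: W)
  have "bounded (fst ` K)"
    by (intro compact_imp_bounded compact_continuous_image continuous_intros K)
  then have "bounded W"
    unfolding W using bounded_filled[OF K] by (simp add: bounded_interior)
  \<comment> \<open>One parameter governs both the constant \<open>n + 1\<close> and the collar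
    width \<open>1 / (n + 1)\<close>.\<close>
  have "\<exists>n::nat. \<forall>x\<in>W. infdist x (- W) < 1 / (real n + 1) \<longrightarrow> Q (real n + 1) x"
  proof (rule ccontr)
    assume "\<not> ?thesis"
    then obtain x where x: "\<And>n. x n \<in> W" "\<And>n. infdist (x n) (- W) < 1 / (real n + 1)"
      "\<And>n. \<not> Q (real n + 1) (x n)"
      by metis
    have "compact (closure W)" using \<open>bounded W\<close> by simp
    moreover have "\<forall>n. x n \<in> closure W" using x(1) closure_subset by blast
    ultimately obtain c s where c: "c \<in> closure W" "strict_mono s" "(x \<circ> s) \<longlonglongrightarrow> c"
      unfolding compact_def by metis
    have "(\<lambda>n. infdist (x n) (- W)) \<longlonglongrightarrow> 0"
    proof (rule tendsto_sandwich[of "\<lambda>_. 0" _ _ "\<lambda>n. 1 / (real n + 1)"])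
      show "(\<lambda>n. 1 / (real n + 1)) \<longlonglongrightarrow> 0"
        using LIMSEQ_inverse_real_of_nat by (simp add: inverse_eq_divide add.commute)
    qed (auto simp: infdist_nonneg less_imp_le[OF x(2)])
    then have "((\<lambda>n. infdist (x n) (- W)) \<circ> s) \<longlonglongrightarrow> 0" using c(2) by (rule LIMSEQ_subseq_LIMSEQ)
    moreover have "(\<lambda>n. infdist ((x \<circ> s) n) (- W)) \<longlonglongrightarrow> infdist c (- W)"
      by (intro tendsto_infdist c(3))
    ultimately have "infdist c (- W) = 0"
      using LIMSEQ_unique by (fastforce simp: comp_def)
    moreover have "- W \<noteq> {}" using \<open>bounded W\<close> not_bounded_UNIV[where 'a=complex] by (metis Compl_empty_eq double_complement)
    ultimately have "c \<in> - W"
      using in_closed_iff_infdist_zero[OF closed_Compl[OF \<open>open W\<close>], of c] by blast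
    then have "c \<in> frontier W" using c(1) \<open>open W\<close> by (simp add: frontier_def interior_open)
    then obtain C r where r: "0 < r" "\<And>y. y \<in> W \<Longrightarrow> y \<in> ball c r \<Longrightarrow> Q C y"
      unfolding Q_def using frontier_access_local[OF K L charts W] by metis
    have "eventually (\<lambda>n. dist ((x \<circ> s) n) c < r) sequentially" using c(3) r(1) by (rule tendstoD)
    moreover have "eventually (\<lambda>n. C \<le> real n) sequentially"
      using filterlim_real_sequentially by (simp add: filterlim_at_top)
    ultimately have "eventually (\<lambda>n. dist ((x \<circ> s) n) c < r \<and> C \<le> real n) sequentially" by eventually_elim simp
    then obtain n where n: "dist (x (s n)) c < r" "C \<le> real n" unfolding eventually_sequentially by auto
    have "real n \<le> real (s n)" using c(2) by (simp add: seq_suble)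
    then have "Q (real (s n) + 1) (x (s n))"
      using Q_mono[OF r(2)[of "x (s n)"]] x(1) n by (simp add: dist_commute)
    then show False using x(3) by blast
  qed
  then obtain n :: nat where "\<forall>x\<in>W. infdist x (- W) < 1 / (real n + 1) \<longrightarrow> Q (real n + 1) x" by blast
  then show ?thesis
    by (intro that[of "real n + 1" "1 / (real n + 1)"]) (auto simp: Q_def)
qed

text \<open>A level set of the distance to \<open>- W\<close> inside the collar separates
  \<open>a\<close> from infinity. A logarithm of \<open>x - a\<close> on it would make the
  normalized map to the circle inessential, against Borsuk's theorem.\<close>

lemma no_logarithm_on_collar:
  fixes W :: "complex set"
  assumes W: "open W" "bounded W" "a \<in> W" and "0 < d"
    and m: "continuous_on {x \<in> W. infdist x (- W) < d} m"
    and exp_m: "\<And>x. x \<in> W \<Longrightarrow> infdist x (- W) < d \<Longrightarrow> exp (m x) = x - a"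
  shows False
proof -
  have ne: "- W \<noteq> {}" using W(2) not_bounded_UNIV[where 'a=complex] by (metis Compl_empty_eq double_complement)
  have cl: "closed (- W)" using W(1) by (rule closed_Compl)
  have inW: "x \<in> W" if "0 < infdist x (- W)" for x
    using that in_closed_iff_infdist_zero[OF cl ne, of x] by auto
  \<comment> \<open>Being below \<open>d\<close> puts the level set into the collar; being below the
    distance of \<open>a\<close> to \<open>- W\<close> puts \<open>a\<close> on its inner
    side.\<close>
  define d' where "d' = min (d / 2) (infdist a (- W) / 2)"
  have "infdist a (- W) > 0"
    using in_closed_iff_infdist_zero[OF cl ne, of a] W(3) infdist_nonneg[of a "- W"] by auto
  then have d': "0 < d'" "d' < d" "d' < infdist a (- W)" using \<open>0 < d\<close> by (auto simp: d'_def)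
  define S where "S = {x. infdist x (- W) = d'}"
  have S_sub: "S \<subseteq> {x \<in> W. infdist x (- W) < d}" using inW d' by (auto simp: S_def)
  have "closed S" unfolding S_def
    by (intro closed_Collect_eq continuous_intros)
  moreover have "bounded S" using S_sub W(2) bounded_subset by blast
  ultimately have "compact S" by (simp add: compact_eq_bounded_closed)
  have "a \<notin> S" using d' by (simp add: S_def)
  have "bounded (connected_component_set (- S) a)"
  proof (rule bounded_subset[OF W(2)], rule subsetI)
    fix x assume "x \<in> connected_component_set (- S) a"
    then obtain T where T: "connected T" "T \<subseteq> - S" "a \<in> T" "x \<in> T" by (auto simp: connected_component_def)
    have "connected ((\<lambda>x. infdist x (- W)) ` T)"
      by (intro connected_continuous_image T continuous_intros)
    then have "d' < infdist x (- W)"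
      using connectedD_interval[of "(\<lambda>x. infdist x (- W)) ` T" "infdist x (- W)" "infdist a (- W)" d'] T d'(3)
      by (force simp: S_def)
    then show "x \<in> W" using inW d'(1) by simp
  qed
  moreover have "\<exists>c. homotopic_with_canon (\<lambda>x. True) S (sphere 0 1) (\<lambda>x. inverse (norm (x - a)) *\<^sub>R (x - a)) (\<lambda>x. c)"
    unfolding inessential_eq_continuous_logarithm_circle
  proof (intro exI[of _ "\<lambda>x. Im (m x)"] conjI ballI)
    show "continuous_on S (\<lambda>x. Im (m x))"
      by (intro continuous_intros continuous_on_subset[OF m S_sub])
    show "inverse (norm (x - a)) *\<^sub>R (x - a) = exp (\<i> * of_real (Im (m x)))" if "x \<in> S" for x
    proof -
      have e: "exp (m x) = x - a" using exp_m S_sub that by auto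
      then have "norm (x - a) = exp (Re (m x))" by (metis norm_exp_eq_Re)
      then show ?thesis
        using exp_eq_polar[of "m x"] e by (simp add: cis_conv_exp scaleR_conv_of_real)
    qed
  qed
  ultimately show False
    using Borsuk_map_essential_bounded_component[OF \<open>compact S\<close> \<open>a \<notin> S\<close>] by blast
qed

section \<open>The topmost logarithm\<close>

text \<open>The logarithms of \<open>x - a\<close> form a vertical ladder that is alive far down and
  dead far up, so it has a highest living rung. As \<open>alive\<close> is locally constant, this
  rung moves continuously with \<open>x\<close>.\<close>

lemma topmost_logarithm:
  fixes N :: "complex set"
  assumes a: "a \<notin> N"
    and loc: "\<And>\<zeta>. a + exp \<zeta> \<in> N \<Longrightarrow> \<exists>r>0. \<forall>\<zeta>'\<in>ball \<zeta> r. alive \<zeta>' \<longleftrightarrow> alive \<zeta>"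
    and low: "\<And>\<zeta>. a + exp \<zeta> \<in> N \<Longrightarrow> Im \<zeta> < lo \<Longrightarrow> alive \<zeta>"
    and high: "\<And>\<zeta>. a + exp \<zeta> \<in> N \<Longrightarrow> hi < Im \<zeta> \<Longrightarrow> \<not> alive \<zeta>"
  obtains m where "continuous_on N m" "\<And>x. x \<in> N \<Longrightarrow> exp (m x) = x - a"
proof -
  define top where "top = (\<lambda>x \<zeta>. exp \<zeta> = x - a \<and> alive \<zeta> \<and> (\<forall>\<zeta>'. exp \<zeta>' = x - a \<longrightarrow> Im \<zeta> < Im \<zeta>' \<longrightarrow> \<not> alive \<zeta>'))"
  have shift: "exp (\<zeta> + 2 * of_int k * pi * \<i>) = exp \<zeta>" for \<zeta> k
    by (simp add: exp_eq)
  have ex: "\<exists>\<zeta>. top x \<zeta>" if x: "x \<in> N" for x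
  proof -
    have "x - a \<noteq> 0" using a x by auto
    define L where "L = Ln (x - a)"
    have L: "exp L = x - a" using \<open>x - a \<noteq> 0\<close> by (simp add: L_def)
    define Z where "Z = (\<lambda>k::int. L + 2 * of_int k * pi * \<i>)"
    have Z: "exp (Z k) = x - a" for k using shift L by (simp add: Z_def)
    have ImZ: "Im (Z k) = Im L + 2 * pi * of_int k" for k by (simp add: Z_def)
    have inN: "a + exp (Z k) \<in> N" for k using x by (simp add: Z)
    define S where "S = {k. alive (Z k)}"
    have low_S: "k \<in> S" if "of_int k < (lo - Im L) / (2 * pi)" for k
    proof -
      have "Im (Z k) < lo" using that unfolding ImZ by (simp add: pos_less_divide_eq algebra_simps)
      then show ?thesis using low inN by (simp add: S_def)
    qed
    \<comment> \<open>The condition in \<open>low_S\<close> is strict, so the floor itself may fail;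
      one less never does.\<close>
    have "\<lfloor>(lo - Im L) / (2 * pi)\<rfloor> - 1 \<in> S" by (rule low_S) linarith
    moreover have bound: "k \<le> \<lfloor>(hi - Im L) / (2 * pi)\<rfloor>" if "k \<in> S" for k
    proof -
      have "Im (Z k) \<le> hi" using high[OF inN] that by (force simp: S_def)
      then have "of_int k \<le> (hi - Im L) / (2 * pi)" unfolding ImZ by (simp add: pos_le_divide_eq algebra_simps)
      then show ?thesis by (simp add: le_floor_iff)
    qed
    ultimately obtain K where K: "K \<in> S" "\<And>k. k \<in> S \<Longrightarrow> k \<le> K"
    proof -
      assume ne: "\<lfloor>(lo - Im L) / (2 * pi)\<rfloor> - 1 \<in> S"
      let ?k0 = "\<lfloor>(lo - Im L) / (2 * pi)\<rfloor> - 1" and ?h = "\<lfloor>(hi - Im L) / (2 * pi)\<rfloor>"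
      have fin: "finite (S \<inter> {?k0..?h})" by simp
      have k0: "?k0 \<in> S \<inter> {?k0..?h}" using ne bound by auto
      define K where "K = Max (S \<inter> {?k0..?h})"
      have KS: "K \<in> S \<inter> {?k0..?h}" unfolding K_def using Max_in[OF fin] k0 by blast
      have "k \<le> K" if "k \<in> S" for k
      proof (cases "?k0 \<le> k")
        case True
        then have "k \<in> S \<inter> {?k0..?h}" using bound that by auto
        then show ?thesis unfolding K_def by (rule Max_ge[OF fin])
      next
        case False
        then show ?thesis using KS by auto
      qed
      then show thesis using that KS by blast
    qed
    have "top x (Z K)"
      unfolding top_def
    proof (intro conjI allI impI)
      show "exp (Z K) = x - a" by (rule Z)
      show "alive (Z K)" using K(1) by (simp add: S_def)
      fix \<zeta> assume \<zeta>: "exp \<zeta> = x - a" "Im (Z K) < Im \<zeta>"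
      have "exp \<zeta> = exp (Z K)" using \<zeta>(1) Z by simp
      then obtain n :: int where n: "\<zeta> = Z K + of_int (2 * n) * pi * \<i>" unfolding exp_eq by blast
      have "\<zeta> = Z (K + n)" by (simp add: n Z_def algebra_simps)
      moreover have "0 < n" using \<zeta>(2) by (simp add: n zero_less_mult_iff)
      ultimately show "\<not> alive \<zeta>" using K(2)[of "K + n"] by (auto simp: S_def)
    qed
    then show ?thesis by blast
  qed
  have unique: "\<zeta> = \<zeta>'" if "top x \<zeta>" "top x \<zeta>'" for x \<zeta> \<zeta>'
  proof -
    have "exp \<zeta> = exp \<zeta>'" "Im \<zeta> = Im \<zeta>'"
      using that unfolding top_def by (metis, metis linorder_neqE)
    then obtain n :: int where n: "\<zeta> = \<zeta>' + of_int (2 * n) * pi * \<i>" unfolding exp_eq by blast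
    then have "n = 0" using \<open>Im \<zeta> = Im \<zeta>'\<close> by simp
    then show ?thesis using n by simp
  qed
  define m where "m = (\<lambda>x. SOME \<zeta>. top x \<zeta>)"
  have m: "top x (m x)" if "x \<in> N" for x
    unfolding m_def using ex[OF that] by (rule someI_ex)
  have cont: "\<exists>d>0. \<forall>x\<in>N. dist x x0 < d \<longrightarrow> dist (m x) (m x0) < e" if x0: "x0 \<in> N" and e: "e > 0" for x0 e
  proof -
    define \<zeta>0 where "\<zeta>0 = m x0"
    have \<zeta>0: "exp \<zeta>0 = x0 - a" "alive \<zeta>0" "\<And>\<zeta>'. exp \<zeta>' = x0 - a \<Longrightarrow> Im \<zeta>0 < Im \<zeta>' \<Longrightarrow> \<not> alive \<zeta>'"
      using m[OF x0] by (auto simp: top_def \<zeta>0_def)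
    have x0a: "x0 - a \<noteq> 0" using \<zeta>0(1) by (metis exp_not_eq_zero)
    define Z where "Z = (\<lambda>\<zeta> (j::nat). \<zeta> + 2 * of_nat j * pi * \<i>)"
    have Z: "exp (Z \<zeta> j) = exp \<zeta>" for \<zeta> j using shift[of \<zeta> "int j"] by (simp add: Z_def)
    have ImZ: "Im (Z \<zeta> j) = Im \<zeta> + 2 * pi * of_nat j" for \<zeta> j by (simp add: Z_def)
    have "\<exists>r>0. \<forall>\<zeta>'\<in>ball (Z \<zeta>0 j) r. alive \<zeta>' \<longleftrightarrow> alive (Z \<zeta>0 j)" for j
      by (rule loc) (simp add: Z \<zeta>0(1) x0)
    then obtain r where r: "\<And>j. r j > 0" "\<And>j \<zeta>'. \<zeta>' \<in> ball (Z \<zeta>0 j) (r j) \<Longrightarrow> alive \<zeta>' \<longleftrightarrow> alive (Z \<zeta>0 j)"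
      by metis
    \<comment> \<open>Rungs with index above \<open>n\<close> stay above \<open>hi\<close> even
      after a shift by \<open>1\<close>, so finitely many radii suffice in \<open>s\<close>.\<close>
    obtain n :: nat where n: "(hi + 1 - Im \<zeta>0) / (2 * pi) < real n" using reals_Archimedean2 by blast
    define s where "s = Min (insert 1 (insert e (r ` {..n})))"
    have "s > 0" unfolding s_def using e r(1) by (subst Min_gr_iff) auto
    have s: "s \<le> 1" "s \<le> e" "\<And>j. j \<le> n \<Longrightarrow> s \<le> r j"
      unfolding s_def by (rule Min_le; simp)+
    have "isCont (\<lambda>x. Ln ((x - a) / (x0 - a))) x0"
      using x0a by (intro continuous_intros) auto
    then obtain d where d: "d > 0" "\<And>x. dist x x0 < d \<Longrightarrow> dist (Ln ((x - a) / (x0 - a))) (Ln ((x0 - a) / (x0 - a))) < s"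
      using \<open>s > 0\<close> unfolding continuous_at_eps_delta by metis
    show ?thesis
    proof (intro exI[of _ d] conjI ballI impI)
      fix x assume x: "x \<in> N" "dist x x0 < d"
      \<comment> \<open>This continues the logarithm \<open>\<zeta>0\<close> from \<open>x0\<close>
        to \<open>x\<close>; the principal branch is applied near \<open>1\<close>.\<close>
      define \<zeta> where "\<zeta> = \<zeta>0 + Ln ((x - a) / (x0 - a))"
      have dist: "dist \<zeta> \<zeta>0 < s" using d(2)[OF x(2)] x0a by (simp add: \<zeta>_def dist_norm)
      have "x - a \<noteq> 0" using a x by auto
      then have e\<zeta>: "exp \<zeta> = x - a" using x0a by (simp add: \<zeta>_def exp_add \<zeta>0(1))
      have inball: "Z \<zeta> j \<in> ball (Z \<zeta>0 j) (r j)" if "j \<le> n" for j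
        using dist s(3)[OF that] by (simp add: Z_def dist_norm norm_minus_commute)
      have "top x \<zeta>"
        unfolding top_def
      proof (intro conjI allI impI)
        show "exp \<zeta> = x - a" by fact
        show "alive \<zeta>" using r(2)[OF inball[of 0]] \<zeta>0(2) by (simp add: Z_def)
        fix \<zeta>' assume \<zeta>': "exp \<zeta>' = x - a" "Im \<zeta> < Im \<zeta>'"
        have "exp \<zeta>' = exp \<zeta>" using \<zeta>'(1) e\<zeta> by simp
        then obtain k :: int where k: "\<zeta>' = \<zeta> + of_int (2 * k) * pi * \<i>" unfolding exp_eq by blast
        have "0 < k" using \<zeta>'(2) by (simp add: k zero_less_mult_iff)
        define j where "j = nat k"
        have j: "\<zeta>' = Z \<zeta> j" "0 < j" using \<open>0 < k\<close> by (simp_all add: k Z_def j_def)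
        show "\<not> alive \<zeta>'"
        proof (cases "j \<le> n")
          case True
          have "Im \<zeta>0 < Im (Z \<zeta>0 j)" using j(2) by (simp add: ImZ)
          then have "\<not> alive (Z \<zeta>0 j)" using \<zeta>0(1,3) Z by metis
          then show ?thesis using r(2)[OF inball[OF True]] j(1) by simp
        next
          case False
          have "\<bar>Im (\<zeta> - \<zeta>0)\<bar> < 1" using abs_Im_le_cmod[of "\<zeta> - \<zeta>0"] dist s(1) by (simp add: dist_norm)
          moreover have "hi + 1 - Im \<zeta>0 < 2 * pi * real n" using n by (simp add: pos_divide_less_eq mult.commute)
          moreover have "2 * pi * real n \<le> 2 * pi * real j" using False by simp
          ultimately have "hi < Im \<zeta>'" unfolding j(1) ImZ minus_complex.simps by linarith
          then show ?thesis using high[of \<zeta>'] \<zeta>'(1) x(1) by simp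
        qed
      qed
      then have "m x = \<zeta>" using unique m[OF x(1)] by blast
      then show "dist (m x) (m x0) < e" using dist s(2) by (simp add: \<zeta>0_def)
    qed (rule d(1))
  qed
  show ?thesis
  proof (rule that[of m])
    show "continuous_on N m" unfolding continuous_on_iff using cont by blast
    show "exp (m x) = x - a" if "x \<in> N" for x using m[OF that] by (simp add: top_def)
  qed
qed

text \<open>Subtracting a multiple of \<open>z - fst x\<close> does not change the value at
  \<open>x\<close>, so the hull inequality applies to every representative.\<close>

lemma norm_le_qnorm_of_hull:
  assumes K: "compact K" and f: "poly_fun2 f" and x: "x \<in> poly_hull2 K"
  shows "norm (f x) \<le> qnorm K (fst x) f"
proof (rule field_le_epsilon)
  fix e :: real assume "e > 0"
  then obtain g where g: "poly_fun2 g" "\<And>k. k \<in> K \<Longrightarrow> norm (f k - (fst k - fst x) * g k) \<le> qnorm K (fst x) f + e"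
    using qnorm_lessD[OF K f, of "fst x" "qnorm K (fst x) f + e"] by auto
  have "poly_fun2 (\<lambda>k. f k - (fst k - fst x) * g k)" by (intro poly_fun2_intros f g)
  then have "norm (f x - (fst x - fst x) * g x) \<le> qnorm K (fst x) f + e"
    using x g(2) unfolding poly_hull2_def by blast
  then show "norm (f x) \<le> qnorm K (fst x) f + e" by simp
qed

text \<open>The peaking function \<open>(x - b) / (z - b)\<close> is at most \<open>C\<close> on all
  of \<open>K\<close>, and at most \<open>\<eta>\<close> outside the disc of radius
  \<open>\<rho>\<close>, since there \<open>norm (z - b) \<ge> \<rho> / 2\<close>.\<close>

lemma qnorm_le_local_sup:
  assumes K: "compact K" and b: "b \<notin> fst ` K" "b \<notin> filled K"
    and C: "\<And>l. l \<in> fst ` K \<Longrightarrow> norm (x - b) \<le> C * norm (b - l)" "0 \<le> C"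
    and small: "norm (x - b) \<le> \<rho> / 2" "norm (x - b) \<le> \<eta> * \<rho> / 2" "0 < \<rho>" "0 \<le> \<eta>"
    and f: "poly_fun2 f" "\<And>k. k \<in> K \<Longrightarrow> norm (f k) \<le> F" "0 \<le> F"
    and s: "\<And>k. k \<in> K \<Longrightarrow> norm (fst k - x) < \<rho> \<Longrightarrow> norm (f k) \<le> s" "0 \<le> s"
  shows "qnorm K x f \<le> C * s + \<eta> * F"
proof (rule qnorm_localize[OF K b f(1)])
  show "0 \<le> C * s + \<eta> * F" using C(2) s(2) small(4) f(3) by simp
  fix k assume k: "k \<in> K"
  have pos: "0 < norm (fst k - b)" using b(1) k by auto
  show "norm ((x - b) / (fst k - b) * f k) \<le> C * s + \<eta> * F"
  proof (cases "norm (fst k - x) < \<rho>")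
    case True
    have "norm ((x - b) / (fst k - b)) \<le> C"
      using C(1)[of "fst k"] k pos by (simp add: norm_divide divide_le_eq norm_minus_commute)
    then have "norm ((x - b) / (fst k - b) * f k) \<le> C * s"
      unfolding norm_mult using s(1)[OF k True] C(2) by (intro mult_mono) auto
    then show ?thesis using small(4) f(3) by (simp add: add_increasing2)
  next
    case False
    have "\<rho> / 2 \<le> norm (fst k - b)"
      using norm_triangle_ineq4[of "fst k - b" "x - b"] False small(1) by simp
    then have "\<eta> * \<rho> / 2 \<le> \<eta> * norm (fst k - b)"
      using small(4) mult_left_mono by fastforce
    then have "norm ((x - b) / (fst k - b)) \<le> \<eta>"
      using small(2) pos by (simp add: norm_divide divide_le_eq)
    then have "norm ((x - b) / (fst k - b) * f k) \<le> \<eta> * F"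
      unfolding norm_mult using f(2)[OF k] small(4) by (intro mult_mono) auto
    then show ?thesis using C(2) s(2) by (simp add: add_increasing)
  qed
qed

section \<open>Sheets\<close>

text \<open>For a logarithm \<open>\<psi>\<close> of \<open>z - a\<close> on \<open>K\<close>, the polynomial \<open>q\<close> approximates, over the disc of
  radius \<open>\<rho>\<close> about \<open>a + exp \<zeta>\<close>, the indicator function of the sheets not below \<open>\<zeta>\<close>.\<close>

definition sheet_indicator where
  "sheet_indicator K \<psi> a \<epsilon> q \<zeta> \<rho> \<longleftrightarrow> (\<forall>k\<in>K. norm (fst k - (a + exp \<zeta>)) < \<rho> \<longrightarrow>
     Im \<zeta> - pi < Im (\<psi> k) \<and> norm (q k - 1) < \<epsilon> \<or> Im (\<psi> k) < Im \<zeta> - pi \<and> norm (q k) < \<epsilon>)"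
  for K :: "(complex \<times> complex) set" and \<psi> q :: "complex \<times> complex \<Rightarrow> complex"

lemma sheet_indicator_mono:
  "sheet_indicator K \<psi> a \<epsilon> q \<zeta> \<rho> \<Longrightarrow> \<rho>' \<le> \<rho> \<Longrightarrow> sheet_indicator K \<psi> a \<epsilon> q \<zeta> \<rho>'"
  unfolding sheet_indicator_def by force

text \<open>The fibre over \<open>a + exp \<zeta>\<close> splits at the cut into two compact parts,
  which a polynomial in \<open>w\<close> separates. Violations arbitrarily near would converge to a
  point of this fibre, where the strict inequalities hold.\<close>

lemma sheet_indicator_local:
  assumes K: "compact K" and fibers: "\<And>c. poly_convex1 {w. (c, w) \<in> K}"
    and \<psi>: "continuous_on K \<psi>" "\<And>k. k \<in> K \<Longrightarrow> exp (\<psi> k) = fst k - a" and "0 < \<epsilon>"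
  shows "\<exists>\<rho>>0. \<exists>q. poly_fun2 q \<and> (\<forall>\<zeta>'\<in>ball \<zeta> \<rho>. sheet_indicator K \<psi> a \<epsilon> q \<zeta>' \<rho>)"
proof -
  define c where "c = a + exp \<zeta>"
  \<comment> \<open>Logarithms of one number differ by multiples of \<open>2 * pi * \<i>\<close>, so
    the cut runs midway between two sheets.\<close>
  have not_eq: "Im (\<psi> k) \<noteq> Im \<zeta> - pi" if k: "k \<in> K" "fst k = c" for k
  proof
    assume eq: "Im (\<psi> k) = Im \<zeta> - pi"
    have "exp (\<psi> k) = exp \<zeta>" using \<psi>(2)[OF k(1)] k(2) by (simp add: c_def)
    then obtain n :: int where "\<psi> k = \<zeta> + of_int (2 * n) * pi * \<i>" unfolding exp_eq by blast
    then have "of_int (2 * n + 1) * pi = 0" using eq by (simp add: algebra_simps)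
    then have "2 * n + 1 = 0" by (simp del: of_int_add of_int_mult)
    then show False by presburger
  qed
  \<comment> \<open>The inequalities are not strict in order to make both parts closed;
    \<open>not_eq\<close> keeps them disjoint.\<close>
  define A B where "A = snd ` {k \<in> K. fst k = c \<and> Im \<zeta> - pi \<le> Im (\<psi> k)}"
    and "B = snd ` {k \<in> K. fst k = c \<and> Im (\<psi> k) \<le> Im \<zeta> - pi}"
  have closedK: "closed K" using K by (rule compact_imp_closed)
  have "closed {k \<in> K. fst k = c \<and> Im \<zeta> - pi \<le> Im (\<psi> k)}"
  proof -
    have "closed (K \<inter> (\<lambda>k. (fst k, Im (\<psi> k))) -` ({c} \<times> {Im \<zeta> - pi..}))"
      by (intro continuous_closed_preimage closedK closed_Times continuous_intros \<psi>)
    moreover have "K \<inter> (\<lambda>k. (fst k, Im (\<psi> k))) -` ({c} \<times> {Im \<zeta> - pi..}) = {k \<in> K. fst k = c \<and> Im \<zeta> - pi \<le> Im (\<psi> k)}"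
      by auto
    ultimately show ?thesis by simp
  qed
  then have "compact (K \<inter> {k \<in> K. fst k = c \<and> Im \<zeta> - pi \<le> Im (\<psi> k)})" using K by (rule compact_Int_closed[rotated])
  moreover have "K \<inter> {k \<in> K. fst k = c \<and> Im \<zeta> - pi \<le> Im (\<psi> k)} = {k \<in> K. fst k = c \<and> Im \<zeta> - pi \<le> Im (\<psi> k)}" by blast
  ultimately have A: "compact A"
    unfolding A_def by (intro compact_continuous_image continuous_intros) simp
  have "closed {k \<in> K. fst k = c \<and> Im (\<psi> k) \<le> Im \<zeta> - pi}"
  proof -
    have "closed (K \<inter> (\<lambda>k. (fst k, Im (\<psi> k))) -` ({c} \<times> {..Im \<zeta> - pi}))"
      by (intro continuous_closed_preimage closedK closed_Times continuous_intros \<psi>)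
    moreover have "K \<inter> (\<lambda>k. (fst k, Im (\<psi> k))) -` ({c} \<times> {..Im \<zeta> - pi}) = {k \<in> K. fst k = c \<and> Im (\<psi> k) \<le> Im \<zeta> - pi}"
      by auto
    ultimately show ?thesis by simp
  qed
  then have "compact (K \<inter> {k \<in> K. fst k = c \<and> Im (\<psi> k) \<le> Im \<zeta> - pi})" using K by (rule compact_Int_closed[rotated])
  moreover have "K \<inter> {k \<in> K. fst k = c \<and> Im (\<psi> k) \<le> Im \<zeta> - pi} = {k \<in> K. fst k = c \<and> Im (\<psi> k) \<le> Im \<zeta> - pi}" by blast
  ultimately have B: "compact B"
    unfolding B_def by (intro compact_continuous_image continuous_intros) simp
  have AB: "A \<union> B = {w. (c, w) \<in> K}" by (force simp: A_def B_def)
  have inA: "w \<in> A \<longleftrightarrow> (c, w) \<in> K \<and> Im \<zeta> - pi < Im (\<psi> (c, w))" for w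
    using not_eq[of "(c, w)"] by (force simp: A_def)
  have inB: "w \<in> B \<longleftrightarrow> (c, w) \<in> K \<and> Im (\<psi> (c, w)) < Im \<zeta> - pi" for w
    using not_eq[of "(c, w)"] by (force simp: B_def)
  have "A \<inter> B = {}" using inA inB by fastforce
  moreover have "poly_convex1 (A \<union> B)" unfolding AB by (rule fibers)
  ultimately obtain q0 where q0: "poly_fun1 q0" "\<And>w. w \<in> A \<Longrightarrow> norm (q0 w - 1) < \<epsilon>" "\<And>w. w \<in> B \<Longrightarrow> norm (q0 w) < \<epsilon>"
    using separating_polynomial[OF A B _ _ \<open>0 < \<epsilon>\<close>] by blast
  define q where "q = (\<lambda>k :: complex \<times> complex. q0 (snd k))"
  have q: "poly_fun2 q" unfolding q_def by (rule poly_fun2_poly_snd[OF q0(1)])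
  have "\<exists>n::nat. \<forall>\<zeta>'\<in>ball \<zeta> (1 / (real n + 1)). sheet_indicator K \<psi> a \<epsilon> q \<zeta>' (1 / (real n + 1))"
  proof (rule ccontr)
    assume "\<not> ?thesis"
    then have "\<forall>n::nat. \<exists>\<zeta>' k. dist \<zeta> \<zeta>' < 1 / (real n + 1) \<and> k \<in> K \<and> norm (fst k - (a + exp \<zeta>')) < 1 / (real n + 1) \<and>
       \<not> (Im \<zeta>' - pi < Im (\<psi> k) \<and> norm (q k - 1) < \<epsilon> \<or> Im (\<psi> k) < Im \<zeta>' - pi \<and> norm (q k) < \<epsilon>)"
      unfolding sheet_indicator_def by (simp add: Bex_def)
    then obtain Z \<kappa> where Z: "\<And>n::nat. dist \<zeta> (Z n) < 1 / (real n + 1)" "\<And>n. \<kappa> n \<in> K"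
      "\<And>n. norm (fst (\<kappa> n) - (a + exp (Z n))) < 1 / (real n + 1)"
      "\<And>n. \<not> (Im (Z n) - pi < Im (\<psi> (\<kappa> n)) \<and> norm (q (\<kappa> n) - 1) < \<epsilon> \<or> Im (\<psi> (\<kappa> n)) < Im (Z n) - pi \<and> norm (q (\<kappa> n)) < \<epsilon>)"
      by metis
    have lim0: "(\<lambda>n. 1 / (real n + 1)) \<longlonglongrightarrow> 0"
      using LIMSEQ_inverse_real_of_nat by (simp add: inverse_eq_divide add.commute)
    obtain k s where k: "k \<in> K" "strict_mono s" "(\<kappa> \<circ> s) \<longlonglongrightarrow> k"
      using K Z(2) unfolding compact_def by metis
    have "(\<lambda>n. dist (Z n) \<zeta>) \<longlonglongrightarrow> 0"
      by (rule tendsto_sandwich[OF _ _ tendsto_const lim0]) (auto simp: dist_commute less_imp_le[OF Z(1)])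
    then have "Z \<longlonglongrightarrow> \<zeta>" by (subst tendsto_dist_iff)
    then have Zs: "(\<lambda>n. Z (s n)) \<longlonglongrightarrow> \<zeta>" using LIMSEQ_subseq_LIMSEQ[OF _ k(2)] by (simp add: comp_def)
    have ks: "(\<lambda>n. \<kappa> (s n)) \<longlonglongrightarrow> k" using k(3) by (simp add: comp_def)
    have "(\<lambda>n. fst (\<kappa> n) - (a + exp (Z n))) \<longlonglongrightarrow> 0"
      by (rule Lim_null_comparison[OF _ lim0]) (auto simp: less_imp_le[OF Z(3)])
    then have "(\<lambda>n. fst (\<kappa> (s n)) - (a + exp (Z (s n)))) \<longlonglongrightarrow> 0"
      using LIMSEQ_subseq_LIMSEQ[OF _ k(2)] by (fastforce simp: comp_def)
    moreover have "(\<lambda>n. fst (\<kappa> (s n)) - (a + exp (Z (s n)))) \<longlonglongrightarrow> fst k - (a + exp \<zeta>)"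
      by (intro tendsto_intros ks Zs)
    ultimately have fk: "fst k = c" using LIMSEQ_unique by (fastforce simp: c_def)
    have \<psi>s: "(\<lambda>n. \<psi> (\<kappa> (s n))) \<longlonglongrightarrow> \<psi> k"
      using continuous_on_tendsto_compose[OF \<psi>(1) ks k(1)] Z(2) by simp
    have qs: "(\<lambda>n. q (\<kappa> (s n))) \<longlonglongrightarrow> q k"
      using continuous_on_tendsto_compose[OF continuous_on_poly_fun2[OF q, of K] ks k(1)] Z(2) by simp
    have diff: "(\<lambda>n. Im (\<psi> (\<kappa> (s n))) - (Im (Z (s n)) - pi)) \<longlonglongrightarrow> Im (\<psi> k) - (Im \<zeta> - pi)"
      by (intro tendsto_intros \<psi>s Zs)
    have kw: "k = (c, snd k)" using fk by (simp add: prod_eq_iff)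
    show False
    proof (cases "Im \<zeta> - pi < Im (\<psi> k)")
      case True
      then have "snd k \<in> A" using inA k(1) kw by metis
      then have "norm (q k - 1) < \<epsilon>" using q0(2) by (simp add: q_def)
      then have "eventually (\<lambda>n. norm (q (\<kappa> (s n)) - 1) < \<epsilon>) sequentially"
        by (rule order_tendstoD(2)[rotated]) (intro tendsto_intros qs)
      moreover have "eventually (\<lambda>n. 0 < Im (\<psi> (\<kappa> (s n))) - (Im (Z (s n)) - pi)) sequentially"
        by (rule order_tendstoD(1)[OF diff]) (use True in simp)
      ultimately have "eventually (\<lambda>n. False) sequentially"
        by eventually_elim (use Z(4) in auto)
      then show False by simp
    next
      case False
      then have less: "Im (\<psi> k) < Im \<zeta> - pi" using not_eq[OF k(1) fk] by simp
      then have "snd k \<in> B" using inB k(1) kw by metis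
      then have "norm (q k) < \<epsilon>" using q0(3) by (simp add: q_def)
      then have "eventually (\<lambda>n. norm (q (\<kappa> (s n))) < \<epsilon>) sequentially"
        by (rule order_tendstoD(2)[rotated]) (intro tendsto_intros qs)
      moreover have "eventually (\<lambda>n. Im (\<psi> (\<kappa> (s n))) - (Im (Z (s n)) - pi) < 0) sequentially"
        by (rule order_tendstoD(2)[OF diff]) (use less in simp)
      ultimately have "eventually (\<lambda>n. False) sequentially"
        by eventually_elim (use Z(4) in auto)
      then show False by simp
    qed
  qed
  then obtain n :: nat where "\<forall>\<zeta>'\<in>ball \<zeta> (1 / (real n + 1)). sheet_indicator K \<psi> a \<epsilon> q \<zeta>' (1 / (real n + 1))" by blast
  then show ?thesis using q by (intro exI[of _ "1 / (real n + 1)"]) auto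
qed

text \<open>By compactness of \<open>Z\<close> one index \<open>n\<close> works throughout,
  supplying both the radius \<open>1 / (n + 1)\<close> and the bound \<open>n + 1\<close>.\<close>

lemma sheet_indicator_uniform:
  assumes K: "compact K" and fibers: "\<And>c. poly_convex1 {w. (c, w) \<in> K}"
    and \<psi>: "continuous_on K \<psi>" "\<And>k. k \<in> K \<Longrightarrow> exp (\<psi> k) = fst k - a" and "0 < \<epsilon>"
    and Z: "compact Z"
  obtains \<rho> F where "0 < \<rho>" "\<rho> \<le> 1" "1 \<le> F"
    "\<And>\<zeta>. \<zeta> \<in> Z \<Longrightarrow> \<exists>q. poly_fun2 q \<and> (\<forall>k\<in>K. norm (q k) \<le> F) \<and> (\<forall>\<zeta>'\<in>ball \<zeta> \<rho>. sheet_indicator K \<psi> a \<epsilon> q \<zeta>' \<rho>)"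
proof -
  define Q where "Q = (\<lambda>n::nat. \<lambda>\<zeta>. \<exists>q. poly_fun2 q \<and> (\<forall>k\<in>K. norm (q k) \<le> real n + 1) \<and>
     (\<forall>\<zeta>'\<in>ball \<zeta> (1 / (real n + 1)). sheet_indicator K \<psi> a \<epsilon> q \<zeta>' (1 / (real n + 1))))"
  have "\<exists>n. \<forall>\<zeta>\<in>Z. Q n \<zeta>"
  proof (rule ccontr)
    assume "\<not> ?thesis"
    then obtain \<zeta>s where \<zeta>s: "\<And>n. \<zeta>s n \<in> Z" "\<And>n. \<not> Q n (\<zeta>s n)" by metis
    obtain \<zeta> s where \<zeta>: "\<zeta> \<in> Z" "strict_mono s" "(\<zeta>s \<circ> s) \<longlonglongrightarrow> \<zeta>"
      using Z \<zeta>s(1) unfolding compact_def by metis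
    obtain \<rho> q where \<rho>: "\<rho> > 0" "poly_fun2 q" "\<forall>\<zeta>'\<in>ball \<zeta> \<rho>. sheet_indicator K \<psi> a \<epsilon> q \<zeta>' \<rho>"
      using sheet_indicator_local[OF K fibers \<psi> \<open>0 < \<epsilon>\<close>] by blast
    obtain F where F: "\<And>k. k \<in> K \<Longrightarrow> norm (q k) \<le> F"
      using poly_fun2_bounded[OF K \<rho>(2)] by blast
    have "eventually (\<lambda>n. dist (\<zeta>s (s n)) \<zeta> < \<rho> / 2) sequentially"
      using tendstoD[OF \<zeta>(3), of "\<rho> / 2"] \<rho>(1) by simp
    moreover have "eventually (\<lambda>n. max F (2 / \<rho>) \<le> real n) sequentially"
      using filterlim_real_sequentially unfolding filterlim_at_top by blast
    ultimately have "eventually (\<lambda>n. dist (\<zeta>s (s n)) \<zeta> < \<rho> / 2 \<and> max F (2 / \<rho>) \<le> real n) sequentially"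
      by eventually_elim simp
    then obtain n where n: "dist (\<zeta>s (s n)) \<zeta> < \<rho> / 2" "F \<le> real n" "2 / \<rho> \<le> real n"
      unfolding eventually_sequentially by auto
    have ns: "real n \<le> real (s n)" using \<zeta>(2) by (simp add: seq_suble)
    have "2 / \<rho> < real (s n) + 1" using n ns by linarith
    then have small: "1 / (real (s n) + 1) < \<rho> / 2" using \<rho>(1) by (simp add: field_simps)
    have "sheet_indicator K \<psi> a \<epsilon> q \<zeta>' (1 / (real (s n) + 1))" if "\<zeta>' \<in> ball (\<zeta>s (s n)) (1 / (real (s n) + 1))" for \<zeta>'
    proof -
      have "dist \<zeta> \<zeta>' \<le> dist (\<zeta>s (s n)) \<zeta> + dist (\<zeta>s (s n)) \<zeta>'" by (rule dist_triangle3)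
      then have "\<zeta>' \<in> ball \<zeta> \<rho>" using that n(1) small by simp
      then show ?thesis using \<rho>(3) sheet_indicator_mono small \<rho>(1) by force
    qed
    moreover have "norm (q k) \<le> real (s n) + 1" if "k \<in> K" for k using F[OF that] n ns by linarith
    ultimately have "Q (s n) (\<zeta>s (s n))" unfolding Q_def using \<rho>(2) by blast
    then show False using \<zeta>s(2) by blast
  qed
  then obtain n where "\<And>\<zeta>. \<zeta> \<in> Z \<Longrightarrow> Q n \<zeta>" by blast
  then show ?thesis
    by (intro that[of "1 / (real n + 1)" "real n + 1"]) (simp_all add: Q_def)
qed

section \<open>Polynomial convexity\<close>

lemma filled_eq_empty:
  assumes K: "compact K" and fibers: "\<And>c. poly_convex1 {w. (c, w) \<in> K}"
    and log: "simply_coconnected K"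
    and L: "fst ` K \<subseteq> {z. h z = 0}"
    and charts: "\<And>c. h c = 0 \<Longrightarrow> \<exists>r m M n. chart h c r m M n"
  shows "filled K = {}"
proof (rule ccontr)
  assume "filled K \<noteq> {}"
  then obtain a where a: "a \<in> filled K" by blast
  have aL: "a \<notin> fst ` K" using a by (simp add: filled_def)

  \<comment> \<open>The logarithm on \<open>K\<close> and access to the frontier of
    \<open>W\<close>\<close>
  have "continuous_on K (\<lambda>k. fst k - a)" by (intro continuous_intros)
  moreover have "(\<lambda>k. fst k - a) ` K \<subseteq> - {0}" using aL by force
  ultimately obtain \<psi> where \<psi>: "continuous_on K \<psi>" "\<And>k. k \<in> K \<Longrightarrow> exp (\<psi> k) = fst k - a"
    using log[unfolded simply_coconnected_def] by metis
  define W where "W = interior (fst ` K \<union> filled K)"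
  have "open W" by (simp add: W_def)
  have "filled K \<subseteq> W" unfolding W_def by (intro interior_maximal open_filled K) blast
  then have aW: "a \<in> W" using a by blast
  have "bounded (fst ` K)" by (intro compact_imp_bounded compact_continuous_image continuous_intros K)
  then have "bounded W" unfolding W_def using bounded_filled[OF K] by (simp add: bounded_interior)
  obtain C d where C: "0 < C" "0 < d"
    "\<And>x. x \<in> W \<Longrightarrow> infdist x (- W) < d \<Longrightarrow> x \<in> filled K \<and>
      (\<exists>b. b \<notin> fst ` K \<and> b \<notin> filled K \<and> (\<forall>l\<in>fst ` K. norm (x - b) \<le> C * norm (b - l)) \<and>
        norm (x - b) \<le> C * infdist x (- W))"
    using frontier_access[OF K L charts W_def] by metis

  \<comment> \<open>Choice of constants and the collar \<open>N\<close>\<close>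
  define \<epsilon> where "\<epsilon> = min 1 (1 / (64 * C))"
  \<comment> \<open>The part of \<open>K\<close> near the fibre will contribute at most
    \<open>1 / 32\<close> to a seminorm, and by the choice of \<open>\<eta>\<close> so will the
    rest; together \<open>1 / 16\<close>, as \<open>qnorm_almost_idempotent\<close>
    requires.\<close>
  have \<epsilon>: "0 < \<epsilon>" "\<epsilon> \<le> 1" "C * (2 * \<epsilon>) \<le> 1 / 32"
    using C(1) by (auto simp: \<epsilon>_def min_def field_simps)
  have "bounded (\<psi> ` K)" using compact_continuous_image[OF \<psi>(1) K] by (rule compact_imp_bounded)
  then obtain B where B: "\<And>k. k \<in> K \<Longrightarrow> norm (\<psi> k) \<le> B" unfolding bounded_iff by auto
  have Im_B: "\<bar>Im (\<psi> k)\<bar> \<le> B" if "k \<in> K" for k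
    using B[OF that] abs_Im_le_cmod order_trans by blast
  obtain R where R: "\<And>x. x \<in> W \<Longrightarrow> norm (x - a) \<le> R"
  proof -
    have "bounded ((\<lambda>x. x - a) ` W)" using \<open>bounded W\<close> by (rule bounded_translation_minus)
    then show ?thesis using that unfolding bounded_iff by auto
  qed
  have "- W \<noteq> {}" using \<open>bounded W\<close> not_bounded_UNIV[where 'a=complex] by (metis Compl_empty_eq double_complement)
  define d0 where "d0 = infdist a (- W) / 2"
  have "d0 > 0"
    using in_closed_iff_infdist_zero[OF closed_Compl[OF \<open>open W\<close>] \<open>- W \<noteq> {}\<close>, of a] aW infdist_nonneg[of a "- W"]
    by (auto simp: d0_def)
  \<comment> \<open>This rectangle contains all logarithms of \<open>x - a\<close>, for
    \<open>x\<close> in the collar, whose height is comparable to that of some sheet.\<close>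
  define Z where "Z = cbox (Complex (ln d0) (- B - 1 + pi)) (Complex (ln R) (B + 1 + pi))"
  have "compact Z" by (simp add: Z_def)
  obtain \<rho> F where \<rho>: "0 < \<rho>" "\<rho> \<le> 1" "1 \<le> F"
    "\<And>\<zeta>. \<zeta> \<in> Z \<Longrightarrow> \<exists>q. poly_fun2 q \<and> (\<forall>k\<in>K. norm (q k) \<le> F) \<and> (\<forall>\<zeta>'\<in>ball \<zeta> \<rho>. sheet_indicator K \<psi> a \<epsilon> q \<zeta>' \<rho>)"
    using sheet_indicator_uniform[OF K fibers \<psi> \<epsilon>(1) \<open>compact Z\<close>] by metis
  define \<eta> where "\<eta> = 1 / (64 * (F * F))"
  have "0 < F * F" "F \<le> F * F" using \<rho>(3) by auto
  have \<eta>: "0 < \<eta>" "\<eta> * (F * F + F) \<le> 1 / 32" "\<eta> * (F + F) \<le> 1 / 32"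
  proof -
    show "0 < \<eta>" using \<open>0 < F * F\<close> by (simp add: \<eta>_def)
    then have "\<eta> * F \<le> \<eta> * (F * F)" using \<open>F \<le> F * F\<close> by (intro mult_left_mono) auto
    moreover have "\<eta> * (F * F) = 1 / 64" using \<rho>(3) by (simp add: \<eta>_def)
    ultimately show "\<eta> * (F * F + F) \<le> 1 / 32" "\<eta> * (F + F) \<le> 1 / 32"
      unfolding distrib_left by linarith+
  qed
  \<comment> \<open>The entries give access to outside points \<open>b\<close>, keep
    \<open>a\<close> off the collar, and meet the two smallness conditions of
    \<open>qnorm_le_local_sup\<close>.\<close>
  define \<delta> where "\<delta> = min (min d d0) (min (\<rho> / (2 * C)) (\<eta> * \<rho> / (2 * C)))"
  have \<delta>: "0 < \<delta>" "\<delta> \<le> d" "\<delta> \<le> d0" "C * \<delta> \<le> \<rho> / 2" "C * \<delta> \<le> \<eta> * \<rho> / 2"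
  proof -
    show "0 < \<delta>" "\<delta> \<le> d" "\<delta> \<le> d0" using C(1,2) \<open>d0 > 0\<close> \<rho>(1) \<eta>(1) by (auto simp: \<delta>_def)
    have "\<delta> \<le> \<rho> / (2 * C)" "\<delta> \<le> \<eta> * \<rho> / (2 * C)" by (auto simp: \<delta>_def)
    then show "C * \<delta> \<le> \<rho> / 2" "C * \<delta> \<le> \<eta> * \<rho> / 2" using C(1) by (simp_all add: field_simps)
  qed
  define N where "N = {x \<in> W. infdist x (- W) < \<delta>}"
  have "open N"
  proof -
    have "open (W \<inter> (\<lambda>x. infdist x (- W)) -` {..<\<delta>})"
      by (intro continuous_open_preimage \<open>open W\<close> continuous_intros open_lessThan)
    moreover have "W \<inter> (\<lambda>x. infdist x (- W)) -` {..<\<delta>} = N" by (auto simp: N_def)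
    ultimately show ?thesis by simp
  qed
  have N_filled: "x \<in> filled K" if "x \<in> N" for x using C(3)[of x] that \<delta>(2) by (auto simp: N_def)
  have N_far: "d0 \<le> norm (x - a)" if "x \<in> N" for x
  proof -
    have "infdist a (- W) \<le> infdist x (- W) + dist a x" by (rule infdist_triangle)
    then show ?thesis using that \<delta>(3) unfolding N_def d0_def by (simp add: dist_norm norm_minus_commute)
  qed
  have local_bound: "qnorm K x f \<le> C * (2 * \<epsilon>) + \<eta> * G"
    if x: "x \<in> N" and f: "poly_fun2 f" "\<And>k. k \<in> K \<Longrightarrow> norm (f k) \<le> G" "0 \<le> G"
      "\<And>k. k \<in> K \<Longrightarrow> norm (fst k - x) < \<rho> \<Longrightarrow> norm (f k) \<le> 2 * \<epsilon>" for x f G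
  proof -
    have "x \<in> W" "infdist x (- W) < d" using x \<delta>(2) by (auto simp: N_def)
    then obtain b where b: "b \<notin> fst ` K" "b \<notin> filled K" "\<And>l. l \<in> fst ` K \<Longrightarrow> norm (x - b) \<le> C * norm (b - l)"
      "norm (x - b) \<le> C * infdist x (- W)" using C(3) by blast
    have "C * infdist x (- W) \<le> C * \<delta>" using x C(1) by (simp add: N_def)
    then have "norm (x - b) \<le> \<rho> / 2" "norm (x - b) \<le> \<eta> * \<rho> / 2" using b(4) \<delta>(4,5) by linarith+
    then show ?thesis
      using qnorm_le_local_sup[OF K b(1,2) b(3) less_imp_le[OF C(1)] _ _ \<rho>(1) less_imp_le[OF \<eta>(1)] f(1,2,3,4)] \<epsilon>(1)
      by simp
  qed

  \<comment> \<open>Sheet indicators as almost idempotent elements\<close>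
  define good where "good = (\<lambda>\<zeta> q. poly_fun2 q \<and> (\<forall>k\<in>K. norm (q k) \<le> F) \<and> sheet_indicator K \<psi> a \<epsilon> q \<zeta> \<rho>)"
  \<comment> \<open>One \<open>q\<close> serves a whole ball, as is needed for local constancy. Far
    below or above all sheets the constants \<open>1\<close> and \<open>0\<close> do; the margin
    \<open>1\<close> absorbs the change of \<open>Im \<zeta>'\<close>.\<close>
  have good_ex: "\<exists>q. \<forall>\<zeta>'\<in>ball \<zeta> \<rho>. good \<zeta>' q" if \<zeta>: "a + exp \<zeta> \<in> N" for \<zeta>
  proof -
    have Im_close: "\<bar>Im \<zeta>' - Im \<zeta>\<bar> < 1" if "\<zeta>' \<in> ball \<zeta> \<rho>" for \<zeta>'
      using abs_Im_le_cmod[of "\<zeta>' - \<zeta>"] that \<rho>(2) by (simp add: dist_norm norm_minus_commute)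
    consider "Im \<zeta> < - B - 1 + pi" | "B + 1 + pi < Im \<zeta>" | "- B - 1 + pi \<le> Im \<zeta>" "Im \<zeta> \<le> B + 1 + pi" by linarith
    then show ?thesis
    proof cases
      case 1
      have "good \<zeta>' (\<lambda>_. 1)" if "\<zeta>' \<in> ball \<zeta> \<rho>" for \<zeta>'
      proof -
        have "Im \<zeta>' - pi < Im (\<psi> k)" if "k \<in> K" for k
          using 1 Im_close[OF \<open>\<zeta>' \<in> ball \<zeta> \<rho>\<close>] Im_B[OF that] by linarith
        then show ?thesis unfolding good_def sheet_indicator_def
          using \<rho>(3) \<epsilon>(1) poly_fun2_const by simp
      qed
      then show ?thesis by blast
    next
      case 2
      have "good \<zeta>' (\<lambda>_. 0)" if "\<zeta>' \<in> ball \<zeta> \<rho>" for \<zeta>'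
      proof -
        have "Im (\<psi> k) < Im \<zeta>' - pi" if "k \<in> K" for k
          using 2 Im_close[OF \<open>\<zeta>' \<in> ball \<zeta> \<rho>\<close>] Im_B[OF that] by linarith
        then show ?thesis unfolding good_def sheet_indicator_def
          using \<rho>(3) \<epsilon>(1) poly_fun2_const by simp
      qed
      then show ?thesis by blast
    next
      case 3
      have n: "norm (exp \<zeta>) = exp (Re \<zeta>)" by (rule norm_exp_eq_Re)
      have "d0 \<le> exp (Re \<zeta>)" using N_far[OF \<zeta>] n by simp
      then have "ln d0 \<le> Re \<zeta>" using \<open>d0 > 0\<close> by (metis ln_exp ln_le_cancel_iff exp_gt_zero)
      moreover have "exp (Re \<zeta>) \<le> R" using R[of "a + exp \<zeta>"] \<zeta> n by (simp add: N_def)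
      then have "Re \<zeta> \<le> ln R" by (metis ln_exp ln_le_cancel_iff exp_gt_zero order_less_le_trans)
      ultimately have "\<zeta> \<in> Z" using 3 by (simp add: Z_def in_cbox_complex_iff)
      then show ?thesis using \<rho>(4) unfolding good_def by blast
    qed
  qed
  have good_almost_idempotent: "qnorm K (a + exp \<zeta>) (\<lambda>k. q k * q k - q k) \<le> 1 / 16"
    if \<zeta>: "a + exp \<zeta> \<in> N" and q: "good \<zeta> q" for \<zeta> q
  proof -
    have q': "poly_fun2 q" "\<And>k. k \<in> K \<Longrightarrow> norm (q k) \<le> F" "sheet_indicator K \<psi> a \<epsilon> q \<zeta> \<rho>"
      using q by (auto simp: good_def)
    have "qnorm K (a + exp \<zeta>) (\<lambda>k. q k * q k - q k) \<le> C * (2 * \<epsilon>) + \<eta> * (F * F + F)"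
    proof (rule local_bound[OF \<zeta>])
      show "poly_fun2 (\<lambda>k. q k * q k - q k)" by (intro poly_fun2_intros q')
      show "norm (q k * q k - q k) \<le> F * F + F" if "k \<in> K" for k
      proof -
        have "norm (q k * q k - q k) \<le> norm (q k) * norm (q k) + norm (q k)"
          by (metis norm_mult norm_triangle_ineq4)
        also have "\<dots> \<le> F * F + F" using q'(2)[OF that] \<rho>(3) by (intro add_mono mult_mono) auto
        finally show ?thesis .
      qed
      show "norm (q k * q k - q k) \<le> 2 * \<epsilon>" if k: "k \<in> K" "norm (fst k - (a + exp \<zeta>)) < \<rho>" for k
      proof -
        \<comment> \<open>One of the two factors is below \<open>\<epsilon>\<close>, and then the
          other is at most \<open>2\<close>.\<close>
        have eq: "norm (q k * q k - q k) = norm (q k) * norm (q k - 1)"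
          by (simp add: algebra_simps flip: norm_mult)
        have or: "norm (q k - 1) < \<epsilon> \<or> norm (q k) < \<epsilon>" using q'(3) k unfolding sheet_indicator_def by blast
        have tri: "norm (q k) \<le> norm (q k - 1) + 1" "norm (q k - 1) \<le> norm (q k) + 1"
          using norm_triangle_ineq[of "q k - 1" 1] norm_triangle_ineq4[of "q k" 1] by simp_all
        show ?thesis unfolding eq
        proof (rule disjE[OF or])
          assume "norm (q k - 1) < \<epsilon>"
          then show "norm (q k) * norm (q k - 1) \<le> 2 * \<epsilon>" using tri \<epsilon>(2) by (intro mult_mono) auto
        next
          assume "norm (q k) < \<epsilon>"
          then have "norm (q k - 1) * norm (q k) \<le> 2 * \<epsilon>" using tri \<epsilon>(2) by (intro mult_mono) auto
          then show "norm (q k) * norm (q k - 1) \<le> 2 * \<epsilon>" by (simp add: mult.commute)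
        qed
      qed
    qed (use \<rho>(3) in auto)
    then show ?thesis using \<epsilon>(3) \<eta>(2) by linarith
  qed
  have good_close: "qnorm K (a + exp \<zeta>) (\<lambda>k. p k - q k) \<le> 1 / 2"
    if \<zeta>: "a + exp \<zeta> \<in> N" and p: "good \<zeta> p" and q: "good \<zeta> q" for \<zeta> p q
  proof -
    have p': "poly_fun2 p" "\<And>k. k \<in> K \<Longrightarrow> norm (p k) \<le> F" "sheet_indicator K \<psi> a \<epsilon> p \<zeta> \<rho>"
      using p by (auto simp: good_def)
    have q': "poly_fun2 q" "\<And>k. k \<in> K \<Longrightarrow> norm (q k) \<le> F" "sheet_indicator K \<psi> a \<epsilon> q \<zeta> \<rho>"
      using q by (auto simp: good_def)
    have "qnorm K (a + exp \<zeta>) (\<lambda>k. p k - q k) \<le> C * (2 * \<epsilon>) + \<eta> * (F + F)"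
    proof (rule local_bound[OF \<zeta>])
      show "poly_fun2 (\<lambda>k. p k - q k)" by (intro poly_fun2_intros p' q')
      show "norm (p k - q k) \<le> F + F" if "k \<in> K" for k
        using p'(2)[OF that] q'(2)[OF that] norm_triangle_ineq4[of "p k" "q k"] by linarith
      show "norm (p k - q k) \<le> 2 * \<epsilon>" if k: "k \<in> K" "norm (fst k - (a + exp \<zeta>)) < \<rho>" for k
      proof -
        \<comment> \<open>The cut depends on \<open>\<zeta>\<close> alone, so \<open>p\<close> and
          \<open>q\<close> are close to the same value at \<open>k\<close>.\<close>
        have "norm (p k - 1) < \<epsilon> \<and> norm (q k - 1) < \<epsilon> \<or> norm (p k) < \<epsilon> \<and> norm (q k) < \<epsilon>"
          using p'(3) q'(3) k unfolding sheet_indicator_def by force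
        moreover have "norm (p k - q k) \<le> norm (p k - 1) + norm (q k - 1)" "norm (p k - q k) \<le> norm (p k) + norm (q k)"
          using norm_triangle_ineq4[of "p k - 1" "q k - 1"] norm_triangle_ineq4[of "p k" "q k"] by simp_all
        ultimately show ?thesis by linarith
      qed
    qed (use \<rho>(3) in auto)
    then show ?thesis using \<epsilon>(3) \<eta>(3) by linarith
  qed

  \<comment> \<open>Living sheets and the contradiction\<close>
  define alive where "alive = (\<lambda>\<zeta>. \<exists>q. good \<zeta> q \<and> 1 / 2 < qnorm K (a + exp \<zeta>) q)"
  \<comment> \<open>Any two indicators for \<open>\<zeta>\<close> are close in the seminorm, so the
    choice of \<open>q\<close> does not matter.\<close>
  have alive_iff: "alive \<zeta> \<longleftrightarrow> 1 / 2 < qnorm K (a + exp \<zeta>) q"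
    if \<zeta>: "a + exp \<zeta> \<in> N" and q: "good \<zeta> q" for \<zeta> q
  proof -
    have "1 / 2 < qnorm K (a + exp \<zeta>) p \<longleftrightarrow> 1 / 2 < qnorm K (a + exp \<zeta>) q" if p: "good \<zeta> p" for p
      using p q by (intro qnorm_almost_idempotent_close K good_almost_idempotent good_close \<zeta>) (auto simp: good_def)
    then show ?thesis unfolding alive_def using q by blast
  qed
  have loc: "\<exists>r>0. \<forall>\<zeta>'\<in>ball \<zeta> r. alive \<zeta>' \<longleftrightarrow> alive \<zeta>" if \<zeta>: "a + exp \<zeta> \<in> N" for \<zeta>
  proof -
    obtain q where q: "\<And>\<zeta>'. \<zeta>' \<in> ball \<zeta> \<rho> \<Longrightarrow> good \<zeta>' q" using good_ex[OF \<zeta>] by blast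
    have "open ((\<lambda>\<zeta>. a + exp \<zeta>) -` N)" by (intro open_vimage \<open>open N\<close> continuous_intros)
    then obtain r0 where r0: "r0 > 0" "ball \<zeta> r0 \<subseteq> (\<lambda>\<zeta>. a + exp \<zeta>) -` N"
      using \<zeta> open_contains_ball by (metis vimageI)
    define r where "r = min r0 \<rho>"
    have "r > 0" using r0 \<rho>(1) by (simp add: r_def)
    have inN: "a + exp \<zeta>' \<in> N" and gd: "good \<zeta>' q" if "\<zeta>' \<in> ball \<zeta> r" for \<zeta>'
      using that r0 q by (auto simp: r_def)
    have pq: "poly_fun2 q" using gd[of \<zeta>] \<open>r > 0\<close> by (simp add: good_def)
    define T where "T = (\<lambda>\<zeta>'. qnorm K (a + exp \<zeta>') q) ` ball \<zeta> r"
    have "(\<lambda>\<zeta>'. a + exp \<zeta>') ` ball \<zeta> r \<subseteq> - fst ` K"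
      using inN N_filled by (force simp: filled_def)
    then have "continuous_on (ball \<zeta> r) (\<lambda>\<zeta>'. qnorm K (a + exp \<zeta>') q)"
      by (intro continuous_on_compose2[OF continuous_on_qnorm[OF K pq]] continuous_intros)
    then have "connected T" unfolding T_def by (intro connected_continuous_image) auto
    \<comment> \<open>The value \<open>1 / 2\<close> lies in the gap for almost idempotent elements,
      so the connected set \<open>T\<close> stays on one side of it.\<close>
    moreover have "1 / 2 \<notin> T"
    proof
      assume "1 / 2 \<in> T"
      then obtain \<zeta>' where "\<zeta>' \<in> ball \<zeta> r" "qnorm K (a + exp \<zeta>') q = 1 / 2" by (auto simp: T_def)
      then show False
        using qnorm_almost_idempotent[OF K pq good_almost_idempotent[OF inN gd]] by force
    qed
    ultimately have side: "1 / 2 < s \<longleftrightarrow> 1 / 2 < t" if "s \<in> T" "t \<in> T" for s t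
      using connectedD_interval[of T s t "1 / 2"] connectedD_interval[of T t s "1 / 2"] that by force
    have "alive \<zeta>' \<longleftrightarrow> alive \<zeta>" if "\<zeta>' \<in> ball \<zeta> r" for \<zeta>'
      using alive_iff[OF inN gd, OF that that] alive_iff[OF inN gd, of \<zeta>] \<open>r > 0\<close> side that
      by (simp add: T_def)
    then show ?thesis using \<open>r > 0\<close> by blast
  qed
  \<comment> \<open>Below all sheets the constant \<open>1\<close> is an indicator, and its seminorm
    exceeds \<open>1 / 2\<close> because the collar lies in \<open>filled K\<close>.\<close>
  have low: "alive \<zeta>" if \<zeta>: "a + exp \<zeta> \<in> N" "Im \<zeta> < - B + pi" for \<zeta>
  proof -
    have "Im \<zeta> - pi < Im (\<psi> k)" if "k \<in> K" for k using \<zeta>(2) Im_B[OF that] by linarith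
    then have "good \<zeta> (\<lambda>_. 1)"
      unfolding good_def sheet_indicator_def using \<rho>(3) \<epsilon>(1) poly_fun2_const by simp
    then show ?thesis using N_filled[OF \<zeta>(1)] unfolding alive_def filled_def by blast
  qed
  have high: "\<not> alive \<zeta>" if \<zeta>: "a + exp \<zeta> \<in> N" "B + pi < Im \<zeta>" for \<zeta>
  proof -
    have "Im (\<psi> k) < Im \<zeta> - pi" if "k \<in> K" for k using \<zeta>(2) Im_B[OF that] by linarith
    then have "good \<zeta> (\<lambda>_. 0)"
      unfolding good_def sheet_indicator_def using \<rho>(3) \<epsilon>(1) poly_fun2_const by simp
    moreover have "qnorm K (a + exp \<zeta>) (\<lambda>_. 0) \<le> 0" by (rule qnorm_le_sup) auto
    ultimately show ?thesis using alive_iff[OF \<zeta>(1)] by force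
  qed
  have aN: "a \<notin> N" using N_far[of a] \<open>d0 > 0\<close> by auto
  show False
  proof (rule topmost_logarithm[of a N alive "- B + pi" "B + pi"])
    fix m assume m: "continuous_on N m" "\<And>x. x \<in> N \<Longrightarrow> exp (m x) = x - a"
    show False
      using no_logarithm_on_collar[OF \<open>open W\<close> \<open>bounded W\<close> aW \<delta>(1), of m] m by (simp add: N_def)
  qed (fact aN, erule loc, erule (1) low, erule (1) high)
qed

theorem theorem1p4:
  fixes h :: "complex \<Rightarrow> real" and K :: "(complex \<times> complex) set"
  assumes "smooth_real h"
    and "\<forall>z. h z = 0 \<longrightarrow> frechet_derivative h (at z) \<noteq> (\<lambda>_. 0)"
    and "K \<subseteq> {z. h z = 0} \<times> UNIV"
    and "compact K" and "connected K" and "simply_coconnected K"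
    and "\<forall>c. poly_convex1 {w. (c, w) \<in> K}"
  shows "poly_convex2 K"
proof -
  note K = \<open>compact K\<close>
  have L: "fst ` K \<subseteq> {z. h z = 0}" using assms(3) by auto
  have charts: "\<exists>r m M n. chart h c r m M n" if "h c = 0" for c
    using smooth_real_chart[OF assms(1) that] assms(2) that by metis
  have empty: "filled K = {}"
    using filled_eq_empty[OF K _ assms(6) L charts] assms(7) by blast
  have "x \<in> K" if x: "x \<in> poly_hull2 K" for x
  proof (rule ccontr)
    assume "x \<notin> K"
    define c w where "c = fst x" and "w = snd x"
    \<comment> \<open>As \<open>filled K\<close> is empty, this forces the hull to lie over the
      projection of \<open>K\<close>.\<close>
    have "norm (1 :: complex) \<le> qnorm K c (\<lambda>_. 1)"
      unfolding c_def using norm_le_qnorm_of_hull[OF K poly_fun2_const x, of 1] .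
    then have "c \<in> fst ` K" using empty by (force simp: filled_def)
    then have "h c = 0" using L by blast
    then obtain r m M n where chart: "chart h c r m M n" using charts by blast
    note C = chartD[OF chart]
    define C0 where "C0 = 1 + 2 * M / m"
    have "C0 > 0" using C(2,3) by (simp add: C0_def add_pos_nonneg)
    have "w \<notin> poly_hull1 {w. (c, w) \<in> K}"
      using assms(7) \<open>x \<notin> K\<close> by (simp add: poly_convex1_def c_def w_def)
    then obtain p B where p: "poly_fun1 p" "\<And>v. (c, v) \<in> K \<Longrightarrow> norm (p v) \<le> B" "B < norm (p w)"
      by (auto simp: poly_hull1_def not_le)
    obtain v0 where "(c, v0) \<in> K" using \<open>c \<in> fst ` K\<close> by auto
    then have "0 \<le> B" using p(2) norm_ge_zero order_trans by blast
    then have pw: "p w \<noteq> 0" using p(3) by auto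
    define \<theta> where "\<theta> = B / norm (p w)"
    have \<theta>: "0 \<le> \<theta>" "\<theta> < 1" using \<open>0 \<le> B\<close> p(3) pw by (auto simp: \<theta>_def divide_less_eq)
    obtain N where N: "\<theta> ^ N < 1 / (4 * C0)"
      using real_arch_pow_inv[of "1 / (4 * C0)" \<theta>] \<open>C0 > 0\<close> \<theta>(2) by auto
    \<comment> \<open>A high power of the normalized fibre polynomial: it is \<open>1\<close> at
      \<open>x\<close> and below \<open>1 / (4 * C0)\<close> on the fibre of
      \<open>K\<close>.\<close>
    define f where "f = (\<lambda>k :: complex \<times> complex. (1 / p w * p (snd k)) ^ N)"
    have f: "poly_fun2 f" unfolding f_def by (intro poly_fun2_intros poly_fun2_poly_snd p)
    have fx: "f x = 1" using pw by (simp add: f_def w_def)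
    obtain F where F: "0 \<le> F" "\<And>k. k \<in> K \<Longrightarrow> norm (f k) \<le> F" using poly_fun2_bounded[OF K f] by blast
    define s where "s = 1 / (4 * C0)"
    have "s > 0" using \<open>C0 > 0\<close> by (simp add: s_def)
    have f_fiber: "norm (f k) < s" if "k \<in> K" "fst k = c" for k
    proof -
      have "norm (p (snd k)) \<le> B" using p(2)[of "snd k"] that by (metis prod.collapse)
      then have "norm (1 / p w * p (snd k)) \<le> \<theta>"
        using pw by (simp add: \<theta>_def norm_mult norm_divide divide_right_mono)
      then have "norm (f k) \<le> \<theta> ^ N" unfolding f_def norm_power by (intro power_mono) auto
      then show ?thesis using N by (simp add: s_def)
    qed
    obtain \<rho> where \<rho>: "\<rho> > 0" "\<And>k. k \<in> K \<Longrightarrow> norm (fst k - c) < \<rho> \<Longrightarrow> norm (f k) \<le> s"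
    proof -
      \<comment> \<open>The points of \<open>K\<close> where \<open>f\<close> is large project to a
        compact set that misses \<open>c\<close>, hence misses a disc about
        \<open>c\<close>.\<close>
      have "compact (K \<inter> (f -` {y. s \<le> norm y}))"
        by (intro compact_Int_closed K closed_vimage continuous_on_poly_fun2 f closed_Collect_le continuous_intros)
      then have "closed (fst ` (K \<inter> (f -` {y. s \<le> norm y})))"
        by (intro compact_imp_closed compact_continuous_image continuous_intros)
      moreover have "c \<notin> fst ` (K \<inter> (f -` {y. s \<le> norm y}))" using f_fiber by force
      ultimately obtain \<rho> where "\<rho> > 0" "ball c \<rho> \<inter> fst ` (K \<inter> (f -` {y. s \<le> norm y})) = {}"
        using open_Compl open_contains_ball by (metis ComplI disjoint_eq_subset_Compl)
      moreover from this have "norm (f k) \<le> s" if "k \<in> K" "norm (fst k - c) < \<rho>" for k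
        using that by (force simp: dist_norm norm_minus_commute)
      ultimately show thesis using that by blast
    qed
    define \<eta> where "\<eta> = 1 / (4 * (F + 1))"
    have "\<eta> > 0" "\<eta> * F \<le> 1 / 4" using F(1) by (auto simp: \<eta>_def field_simps)
    \<comment> \<open>The point \<open>b\<close> must be so close to \<open>c\<close> that the part
      of \<open>K\<close> outside the disc contributes at most
      \<open>\<eta> * F \<le> 1 / 4\<close>; the total \<open>1 / 2\<close> then contradicts
      \<open>f x = 1\<close>.\<close>
    define t where "t = min (r / 4) (min (\<rho> / 2) (\<eta> * \<rho> / 2))"
    have t: "0 < t" "t \<le> r / 4" "t \<le> \<rho> / 2" "t \<le> \<eta> * \<rho> / 2"
      using C(1) \<rho>(1) \<open>\<eta> > 0\<close> by (auto simp: t_def)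
    define b where "b = c + t *\<^sub>R n"
    have "- h c \<le> m * t / 2" using C(2,5) t(1) by simp
    note A = chart_access[OF chart L _ _ t(1,2) this b_def]
    have b: "0 < h b" "norm (c - b) = t" "\<And>l. l \<in> fst ` K \<Longrightarrow> norm (c - b) \<le> C0 * norm (b - l)"
      unfolding C0_def using A(2,3,4) C(1,5) by simp_all
    have "b \<notin> fst ` K" using b(1) L by auto
    moreover have "b \<notin> filled K" using empty by simp
    ultimately have "qnorm K c f \<le> C0 * s + \<eta> * F"
      by (rule qnorm_le_local_sup[OF K _ _ b(3) less_imp_le[OF \<open>C0 > 0\<close>] _ _ \<rho>(1) less_imp_le[OF \<open>\<eta> > 0\<close>] f F(2,1) \<rho>(2) less_imp_le[OF \<open>s > 0\<close>]])
        (use b(2) t in auto)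
    also have "C0 * s = 1 / 4" using \<open>C0 > 0\<close> by (simp add: s_def)
    finally have "qnorm K c f \<le> 1 / 2" using \<open>\<eta> * F \<le> 1 / 4\<close> by linarith
    then show False using norm_le_qnorm_of_hull[OF K f x] fx by (simp add: c_def)
  qed
  moreover have "K \<subseteq> poly_hull2 K" by (auto simp: poly_hull2_def)
  ultimately show ?thesis unfolding poly_convex2_def by blast
qed

end
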